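(* Let $\nu_0$ be a Borel probability measure on $(0,+\infty)$ with $\int_0^{+\infty}x\,\nu_0(\mathrm dx)<+\infty$. Let $T\in(0,+\infty)$, respectively $T=+\infty$ together with $\beta<1+\frac\rho\delta$. Then there exists a unique equilibrium $(\widehat{\mathbf u},\widehat q)$ for the deterministic mean-field game with finite time horizon $T$, respectively infinite time horizon, among all equilibria $(\widetilde{\mathbf u},\widetilde q)\in\mathcal U_T\times\mathcal Q_T$, respectively $(\widetilde{\mathbf u},\widetilde q)\in\mathcal U_\infty\times\mathcal Q_\infty$. More precisely, $\widehat{\mathbf u}=z^{(T,\widehat q)}$ in the finite horizon case and $\widehat{\mathbf u}=z^{(\infty,\widehat q)}$ in the infinite horizon case; in both cases $\widehat q$ is the unique solution $y:[0,T]\to(0,+\infty)$ to $$\frac{\mathrm d}{\mathrm ds}y_s=-\delta y_s+\int_s^Te^{-(\rho+\delta)(u-s)}y_u^{-\beta}\,\mathrm du,\quad s\in[0,T],\qquad y_0=\int_0^{+\infty}y\,\nu_0(\mathrm dy).$$ In particular, the result applies to Dirac initial distributions $\nu_0=\delta_x$ (the unit mass at $x$), for every $x>0$.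
   Context: Fixed constants $\delta,\rho,\beta>0$; $T\in(0,+\infty]$, and $[0,T]$ means $[0,+\infty)$ if $T=+\infty$. Admissible controls: for $T<+\infty$, $\mathcal U_T$ is the set of measurable $\mathbf u:[0,T]\to[0,+\infty)$ with $\int_0^Tu_s^2\,\mathrm ds<+\infty$; $\mathcal U_\infty$ is the set of measurable $\mathbf u:[0,\infty)\to[0,+\infty)$ with $\int_0^su_r\,\mathrm dr<+\infty$ for all $s\ge0$ and $\int_0^{+\infty}e^{-\rho s}u_s^2\,\mathrm ds<+\infty$. Controls equal Lebesgue-a.e. are identified. State: $X_s^{x,\mathbf u}=e^{-\delta s}x+\int_0^se^{-\delta(s-r)}u_r\,\mathrm dr$, the solution of $\frac{\mathrm d}{\mathrm ds}X_s=-\delta X_s+u_s$, $X_0=x$. The flow is $\Phi_s^{\mathbf u}(x)=X_s^{x,\mathbf u}$, $x\in\mathbb R$, and $\nu_s^{\nu_0,\mathbf u}:=(\Phi_s^{\mathbf u})_\#\nu_0$ is the pushforward of $\nu_0$. Functional: for measurable $q:[0,T]\to(0,+\infty)$, $J_{T,q}(x,\mathbf u)=\int_0^Te^{-\rho s}\{X_s^{x,\mathbf u}q_s^{-\beta}-\tfrac12u_s^2\}\,\mathrm ds$. Equilibrium of the deterministic mean-field game (given $\nu_0$): a pair $(\widehat{\mathbf u},\widehat q)$ with $\widehat{\mathbf u}\in\mathcal U_T$ and $\widehat q:[0,T]\to(0,+\infty)$ measurable such that (i) $J_{T,\widehat q}(x,\widehat{\mathbf u})\ge J_{T,\widehat q}(x,\mathbf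 u)$ for all $\mathbf u\in\mathcal U_T$ and $\nu_0$-a.e. $x>0$; (ii) $\widehat q_s=\int_0^{+\infty}x\,\nu_s^{\nu_0,\widehat{\mathbf u}}(\mathrm dx)$ for all $s\in[0,T]$. For measurable $q:[0,T]\to(0,+\infty)$, $z^{(T,q)}_s=\int_s^Te^{-(\rho+\delta)(r-s)}q_r^{-\beta}\,\mathrm dr$, $s\in[0,T]$. For $T<+\infty$, $\mathcal Q_T$ is the set of measurable $q:[0,T]\to(0,+\infty)$ with $q^{-\beta}$ Lebesgue integrable on $(0,T]$. $\mathcal Q_\infty$ is the set of measurable $q:[0,\infty)\to(0,+\infty)$ such that $q^{-\beta}$ is locally Lebesgue integrable on $[0,+\infty)$ and $z^{(\infty,q)}$ is bounded. A solution of the integro-differential equation with $y_0=x$ is a function $y\in C^1([0,T];(0,+\infty))$ satisfying it for all $s\in[0,T]$, or equivalently a function $y\in C([0,T];(0,+\infty))$ with $y_s=e^{-\delta s}x+\int_0^se^{-\delta(s-r)}\int_r^Te^{-(\rho+\delta)(u-r)}y_u^{-\beta}\,\mathrm du\,\mathrm dr$ for all $s\in[0,T]$ (integrals being convergent). *)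

theory Defs
  imports "HOL-Probability.Probability"
begin

text \<open>
  Horizons are extended reals \<open>T > 0\<close>; a function on \<open>[0,T]\<close> is a total function on
  the reals of which only the values on \<open>[0,T]\<close> matter.
\<close>

text \<open>The interval \<open>[s,T]\<close>, to be read as \<open>[s,+\<infinity>)\<close> if \<open>T = \<infinity>\<close>.\<close>

definition horizon :: "ereal \<Rightarrow> real \<Rightarrow> real set" where
  "horizon T s = {r. s \<le> r \<and> ereal r \<le> T}"

lemma horizon_ereal [simp]: "horizon (ereal t) s = {s..t}"
  by (auto simp: horizon_def)

lemma horizon_infinity [simp]: "horizon \<infinity> s = {s..}"
  by (auto simp: horizon_def)

definition admissible :: "real \<Rightarrow> ereal \<Rightarrow> (real \<Rightarrow> real) set" where
  "admissible \<rho> T = {u.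
     u \<in> borel_measurable (restrict_space borel (horizon T 0)) \<and>
     (\<forall>s\<in>horizon T 0. 0 \<le> u s) \<and>
     (if T = \<infinity> then
        (\<forall>s\<ge>0. set_integrable lborel {0..s} u) \<and>
        set_integrable lborel {0..} (\<lambda>s. exp (- \<rho> * s) * (u s)\<^sup>2)
      else set_integrable lborel (horizon T 0) (\<lambda>s. (u s)\<^sup>2))}"

definition state :: "real \<Rightarrow> (real \<Rightarrow> real) \<Rightarrow> real \<Rightarrow> real \<Rightarrow> real" where
  "state \<delta> u s x = exp (- \<delta> * s) * x + (LINT r:{0..s}|lborel. exp (- \<delta> * (s - r)) * u r)"

definition state_law :: "real \<Rightarrow> real measure \<Rightarrow> (real \<Rightarrow> real) \<Rightarrow> real \<Rightarrow> real measure" where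
  "state_law \<delta> \<nu> u s = distr \<nu> borel (state \<delta> u s)"

text \<open>
  Integral with values in the extended reals (positive part minus negative part; note that
  \<open>ennreal\<close> truncates negative reals to 0). For admissible controls and \<open>x > 0\<close>, the negative
  part of the integrand of the functional below always has finite integral, but its positive
  part may have infinite integral for a general measurable \<open>q\<close>, in which case the Bochner
  integral would be the junk value 0 instead of \<open>+\<infinity>\<close>.
\<close>

definition ext_integral :: "real set \<Rightarrow> (real \<Rightarrow> real) \<Rightarrow> ereal" where
  "ext_integral A f =
     enn2ereal (\<integral>\<^sup>+s\<in>A. ennreal (f s) \<partial>lborel) - enn2ereal (\<integral>\<^sup>+s\<in>A. ennreal (- f s) \<partial>lborel)"

definition payoff ::
  "real \<Rightarrow> real \<Rightarrow> real \<Rightarrow> ereal \<Rightarrow> (real \<Rightarrow> real) \<Rightarrow> real \<Rightarrow> (real \<Rightarrow> real) \<Rightarrow> ereal" where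
  "payoff \<delta> \<rho> \<beta> T q x u = ext_integral (horizon T 0)
     (\<lambda>s. exp (- \<rho> * s) * (state \<delta> u s x * q s powr (- \<beta>) - (u s)\<^sup>2 / 2))"

definition positive_paths :: "ereal \<Rightarrow> (real \<Rightarrow> real) set" where
  "positive_paths T = {q. q \<in> borel_measurable (restrict_space borel (horizon T 0)) \<and>
     (\<forall>s\<in>horizon T 0. 0 < q s)}"

definition equilibrium ::
  "real \<Rightarrow> real \<Rightarrow> real \<Rightarrow> ereal \<Rightarrow> real measure \<Rightarrow> (real \<Rightarrow> real) \<Rightarrow> (real \<Rightarrow> real) \<Rightarrow> bool" where
  "equilibrium \<delta> \<rho> \<beta> T \<nu> u q \<longleftrightarrow>
     u \<in> admissible \<rho> T \<and> q \<in> positive_paths T \<and>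
     (AE x in \<nu>. 0 < x \<longrightarrow> (\<forall>v\<in>admissible \<rho> T. payoff \<delta> \<rho> \<beta> T q x v \<le> payoff \<delta> \<rho> \<beta> T q x u)) \<and>
     (\<forall>s\<in>horizon T 0. q s = (LINT x:{0<..}|state_law \<delta> \<nu> u s. x))"

definition costate_integrand :: "real \<Rightarrow> real \<Rightarrow> real \<Rightarrow> (real \<Rightarrow> real) \<Rightarrow> real \<Rightarrow> real \<Rightarrow> real" where
  "costate_integrand \<delta> \<rho> \<beta> q s r = exp (- (\<rho> + \<delta>) * (r - s)) * q r powr (- \<beta>)"

definition costate :: "real \<Rightarrow> real \<Rightarrow> real \<Rightarrow> ereal \<Rightarrow> (real \<Rightarrow> real) \<Rightarrow> real \<Rightarrow> real" where
  "costate \<delta> \<rho> \<beta> T q s = (LINT r:horizon T s|lborel. costate_integrand \<delta> \<rho> \<beta> q s r)"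

text \<open>
  The class \<open>Q\<^sub>T\<close>. For \<open>T = \<infinity>\<close>, boundedness of \<open>costate\<close> (which is nonnegative) includes the convergence of the
  defining integrals, which has to be required explicitly as Bochner integrals are total.
\<close>

definition class_Q :: "real \<Rightarrow> real \<Rightarrow> real \<Rightarrow> ereal \<Rightarrow> (real \<Rightarrow> real) set" where
  "class_Q \<delta> \<rho> \<beta> T = {q. q \<in> positive_paths T \<and>
     (if T = \<infinity> then
        (\<forall>s\<ge>0. set_integrable lborel {0..s} (\<lambda>r. q r powr (- \<beta>))) \<and>
        (\<forall>s\<ge>0. set_integrable lborel {s..} (costate_integrand \<delta> \<rho> \<beta> q s)) \<and>
        (\<exists>C. \<forall>s\<ge>0. costate \<delta> \<rho> \<beta> T q s \<le> C)
      else set_integrable lborel (horizon T 0 - {0}) (\<lambda>r. q r powr (- \<beta>)))}"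

text \<open>Uniqueness: controls are identified Lebesgue-a.e., whereas \<open>q\<close> is determined pointwise.\<close>

definition unique_equilibrium ::
  "real \<Rightarrow> real \<Rightarrow> real \<Rightarrow> ereal \<Rightarrow> real measure \<Rightarrow> (real \<Rightarrow> real) \<Rightarrow> (real \<Rightarrow> real) \<Rightarrow> bool" where
  "unique_equilibrium \<delta> \<rho> \<beta> T \<nu> u q \<longleftrightarrow>
     equilibrium \<delta> \<rho> \<beta> T \<nu> u q \<and> q \<in> class_Q \<delta> \<rho> \<beta> T \<and>
     (\<forall>u' q'. equilibrium \<delta> \<rho> \<beta> T \<nu> u' q' \<and> q' \<in> class_Q \<delta> \<rho> \<beta> T \<longrightarrow>
        (AE s in lborel. s \<in> horizon T 0 \<longrightarrow> u' s = u s) \<and> (\<forall>s\<in>horizon T 0. q' s = q s))"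

definition ide_solution ::
  "real \<Rightarrow> real \<Rightarrow> real \<Rightarrow> ereal \<Rightarrow> real \<Rightarrow> (real \<Rightarrow> real) \<Rightarrow> bool" where
  "ide_solution \<delta> \<rho> \<beta> T y0 y \<longleftrightarrow>
     (\<forall>s\<in>horizon T 0. 0 < y s) \<and>
     (\<exists>y'. continuous_on (horizon T 0) y' \<and>
        (\<forall>s\<in>horizon T 0.
           (y has_real_derivative y' s) (at s within horizon T 0) \<and>
           set_integrable lborel (horizon T s) (\<lambda>r. exp (- (\<rho> + \<delta>) * (r - s)) * y r powr (- \<beta>)) \<and>
           y' s = - \<delta> * y s
             + (LINT r:horizon T s|lborel. exp (- (\<rho> + \<delta>) * (r - s)) * y r powr (- \<beta>)))) \<and>
     y 0 = y0"

definition unique_ide_solution ::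
  "real \<Rightarrow> real \<Rightarrow> real \<Rightarrow> ereal \<Rightarrow> real \<Rightarrow> (real \<Rightarrow> real) \<Rightarrow> bool" where
  "unique_ide_solution \<delta> \<rho> \<beta> T y0 y \<longleftrightarrow>
     ide_solution \<delta> \<rho> \<beta> T y0 y \<and>
     (\<forall>w. ide_solution \<delta> \<rho> \<beta> T y0 w \<longrightarrow> (\<forall>s\<in>horizon T 0. w s = y s))"

text \<open>The \<open>\<sigma>\<close>-algebra of Borel probability measures on \<open>(0,+\<infinity>)\<close>.\<close>

abbreviation pos_borel :: "real measure" where
  "pos_borel \<equiv> restrict_space borel {0<..}"

end

theory Submission
  imports Defs
begin

text \<open>
  Write \<open>z\<close> for the costate of a path \<open>q\<close>. The game reduces to the integro-differential equation in
  two steps.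

  \<^item> Given \<open>q\<close>, Tonelli's theorem turns the part of the payoff that is linear in the control \<open>v\<close> into
    \<open>\<integral> e\<^sup>-\<^sup>\<rho>\<^sup>s z v ds\<close>. Completing the square, the payoff is a constant minus
    \<open>\<integral> e\<^sup>-\<^sup>\<rho>\<^sup>s (v - z)\<^sup>2 ds / 2\<close> (\<open>payoff_complete_square\<close>). Hence \<open>z\<close> is optimal whatever the initial state
    is, and every optimal control equals \<open>z\<close> almost everywhere.

  \<^item> The flow is affine in the initial state, so the mean of the population is the state started
    at the mean of the initial law (\<open>state_law_mean\<close>). With control \<open>z\<close>, consistency of \<open>q\<close> says
    precisely that \<open>q\<close> solves the equation.

  Uniqueness for the equation is a monotonicity argument of Lasry--Lions type. For two solutions
  \<open>y\<close>, \<open>w\<close> with costates \<open>z\<close>, \<open>v\<close> the quantity \<open>D = e\<^sup>-\<^sup>\<rho>\<^sup>s (y - w) (z - v)\<close> is nondecreasing, because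
  \<open>x \<mapsto> x powr (- \<beta>)\<close> is decreasing, and \<open>D\<close> vanishes at time 0. Were \<open>D\<close> positive at some time \<open>s\<close>, then
  \<open>y - w\<close> would keep its sign from \<open>s\<close> on; but costates depend on the future only and reverse the
  order of paths, so \<open>z - v\<close> would have the opposite sign at \<open>s\<close>. Hence \<open>D\<close> vanishes identically, and
  so does its derivative, which forces \<open>z = v\<close> and then \<open>y = w\<close> (\<open>ide_solution_unique\<close>). As
  the sign argument replaces a condition at the end of the horizon, it covers finite and infinite
  horizons at once.

  Existence comes from Banach's fixed point theorem in the supremum norm. As the path enters the
  equation through a decreasing function, the evident fixed point map reverses the order and need
  not contract. Adding \<open>M y\<close> to \<open>y powr (- \<beta>)\<close>, with \<open>M\<close> at least the Lipschitz constant of the power on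
  the relevant range, gives a nondecreasing \<open>M\<close>-Lipschitz function; on the other side of the
  equation the same term is absorbed by replacing \<open>\<delta>\<close> with the \<open>a > \<delta>\<close> that satisfies
  \<open>a (\<rho> + a) = \<delta> (\<rho> + \<delta>) + M\<close>. The new integral operator has norm \<open>1 / (a (\<rho> + a))\<close>, so the map
  contracts with factor \<open>M / (M + \<delta> (\<rho> + \<delta>)) < 1\<close> (\<open>discounted_state_fixed_point\<close>,
  \<open>truncated_ide_solution\<close>). Truncating the power below a level \<open>m > 0\<close> makes it Lipschitz. The
  truncation is harmless in the end: for finite \<open>T\<close> a solution stays above \<open>e\<^sup>-\<^sup>\<delta>\<^sup>T x\<close>, and for infinite
  \<open>T\<close> every constant below both \<open>x\<close> and the stationary state is a lower barrier
  (\<open>ide_solution_exists\<close>).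
\<close>

section \<open>Calculus on the time horizon\<close>

lemma has_real_derivative_transform:
  fixes f g :: "real \<Rightarrow> real"
  assumes "s \<in> A" "\<And>r. r \<in> A \<Longrightarrow> g r = f r" "(f has_real_derivative d) (at s within A)"
  shows "(g has_real_derivative d) (at s within A)"
  using assms unfolding has_field_derivative_def by (blast intro: has_derivative_transform)

text \<open>
  Near each of its points, a finite or infinite horizon looks like a compact interval that starts
  at 0. This reduces one-sided derivatives and continuity on both kinds of horizon to the known
  facts about compact intervals.
\<close>

lemma horizon_local:
  assumes "0 < T" "s \<in> horizon T 0"
  obtains b where "0 < b" "s \<in> {0..b}" "{0..b} \<subseteq> horizon T 0"
    "at s within horizon T 0 = at s within {0..b}"
proof (cases T)
  case (real t)
  with assms that[of t] show ?thesis by auto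
next
  case PInf
  have "at s within {0..} = at s within {0..s + 1}"
    by (rule at_within_nhd[of _ "{..<s + 1}"]) auto
  with PInf assms that[of "s + 1"] show ?thesis by auto
qed (use assms in auto)

lemma horizon_nonneg: "s \<in> horizon T 0 \<Longrightarrow> 0 \<le> s"
  by (simp add: horizon_def)

lemma horizon_sets [measurable]: "horizon T s \<in> sets borel"
  unfolding horizon_def by measurable

lemma horizon_Icc: "s \<in> horizon T 0 \<Longrightarrow> {0..s} \<subseteq> horizon T 0"
  by (auto simp: horizon_def intro: order_trans[of "ereal _" "ereal s"])

lemma horizon_Ioo_DERIV:
  assumes "(f has_real_derivative f') (at s within horizon T 0)" "0 < s" "s < b" "b \<in> horizon T 0"
  shows "(f has_real_derivative f') (at s)"
proof -
  have "(f has_real_derivative f') (at s within {0<..<b})"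
    using assms(1) by (rule has_field_derivative_subset) (use horizon_Icc[OF assms(4)] in auto)
  moreover have "at s within {0<..<b} = at s"
    using assms by (intro at_within_open) auto
  ultimately show ?thesis by simp
qed

lemma continuous_on_horizon_local:
  assumes "0 < T" and "\<And>b. b \<in> horizon T 0 \<Longrightarrow> 0 < b \<Longrightarrow> continuous_on {0..b} f"
  shows "continuous_on (horizon T 0) f"
  unfolding continuous_on_eq_continuous_within
proof
  fix s assume s: "s \<in> horizon T 0"
  obtain b where b: "0 < b" "s \<in> {0..b}" "{0..b} \<subseteq> horizon T 0"
    "at s within horizon T 0 = at s within {0..b}"
    using horizon_local[OF assms(1) s] .
  from b have "b \<in> horizon T 0" by auto
  from assms(2)[OF this b(1)] b(2) have "continuous (at s within {0..b}) f"
    by (auto simp: continuous_on_eq_continuous_within)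
  with b(4) show "continuous (at s within horizon T 0) f" by simp
qed

lemma indefinite_integral_has_derivative:
  fixes g :: "real \<Rightarrow> real"
  assumes "0 < T" "continuous_on (horizon T 0) g" "s \<in> horizon T 0"
  shows "((\<lambda>s. LINT r:{0..s}|lborel. g r) has_real_derivative g s) (at s within horizon T 0)"
proof -
  obtain b where b: "0 < b" "s \<in> {0..b}" "{0..b} \<subseteq> horizon T 0"
    "at s within horizon T 0 = at s within {0..b}"
    using horizon_local[OF assms(1,3)] .
  have c: "continuous_on {0..b} g"
    using assms(2) b(3) by (rule continuous_on_subset)
  have eq: "(LINT r:{0..s}|lborel. g r) = integral {0..s} g" if "s \<in> {0..b}" for s
    by (intro set_borel_integral_eq_integral borel_integrable_atLeastAtMost' continuous_on_subset[OF c])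
       (use that in auto)
  have "((\<lambda>s. integral {0..s} g) has_real_derivative g s) (at s within {0..b})"
    by (rule integral_has_real_derivative[OF c b(2)])
  then have "((\<lambda>s. LINT r:{0..s}|lborel. g r) has_real_derivative g s) (at s within {0..b})"
    by (rule has_real_derivative_transform[OF b(2), rotated]) (simp add: eq)
  with b(4) show ?thesis by simp
qed

lemma indefinite_integral_continuous_on:
  fixes g :: "real \<Rightarrow> real"
  assumes "0 < T" "\<And>b. b \<in> horizon T 0 \<Longrightarrow> set_integrable lborel {0..b} g"
  shows "continuous_on (horizon T 0) (\<lambda>s. LINT r:{0..s}|lborel. g r)"
proof (rule continuous_on_horizon_local[OF assms(1)])
  fix b :: real assume b: "b \<in> horizon T 0" "0 < b"
  have i: "set_integrable lborel {0..s} g" if "s \<in> {0..b}" for s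
    using assms(2)[OF b(1)] by (rule set_integrable_subset) (use that in auto)
  have "continuous_on {0..b} (\<lambda>s. integral {0..s} g)"
    by (intro indefinite_integral_continuous_1 set_borel_integral_eq_integral i) (use b in auto)
  then show "continuous_on {0..b} (\<lambda>s. LINT r:{0..s}|lborel. g r)"
    by (rule continuous_on_eq) (simp add: set_borel_integral_eq_integral i)
qed

lemma linear_ode_solution:
  fixes f :: "real \<Rightarrow> real"
  assumes "\<And>s. s \<in> horizon T 0 \<Longrightarrow> (f has_real_derivative k * f s) (at s within horizon T 0)"
    and s: "s \<in> horizon T 0"
  shows "f s = exp (k * s) * f 0"
proof (cases "s = 0")
  case False
  with s have s0: "0 < s" by (auto simp: horizon_def)
  define g where "g = (\<lambda>r. exp (- k * r) * f r)"
  have d: "(g has_real_derivative 0) (at r within horizon T 0)" if "r \<in> horizon T 0" for r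
    unfolding g_def by (auto intro!: derivative_eq_intros assms(1) that)
  have "g s = g 0"
  proof (rule DERIV_isconst_end[OF s0])
    show "continuous_on {0..s} g"
      by (rule continuous_on_subset[OF DERIV_continuous_on[OF d] horizon_Icc[OF s]])
    show "DERIV g r :> 0" if "0 < r" "r < s" for r
      by (rule horizon_Ioo_DERIV[OF d that s]) (use horizon_Icc[OF s] that in auto)
  qed
  then show ?thesis by (simp add: g_def exp_minus field_simps)
qed simp

section \<open>Discounted tails and the controlled state\<close>

text \<open>
  For bounded \<open>h\<close> and \<open>c > 0\<close> this is the only bounded solution of \<open>w' = c w - h\<close> on the half-line.
  Costates are of this form, and so are the auxiliary functions of the fixed point argument.
\<close>

definition discounted_tail :: "real \<Rightarrow> (real \<Rightarrow> real) \<Rightarrow> real \<Rightarrow> real" where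
  "discounted_tail c h s = (LINT r:{s..}|lborel. exp (- c * (r - s)) * h r)"

abbreviation discountable :: "real \<Rightarrow> (real \<Rightarrow> real) \<Rightarrow> bool" where
  "discountable c h \<equiv> set_integrable lborel {0..} (\<lambda>r. exp (- c * r) * h r)"

lemma discount_shift: "exp (- c * (r - s)) * h = exp (c * s) * (exp (- c * r) * (h::real))"
  by (simp add: exp_diff exp_minus field_simps)

lemma discountable_tail_integrable:
  assumes "discountable c h" "0 \<le> s"
  shows "set_integrable lborel {s..} (\<lambda>r. exp (- c * (r - s)) * h r)"
  unfolding discount_shift
  by (intro set_integrable_mult_right set_integrable_subset[OF assms(1)]) (use assms in auto)

text \<open>
  Separating the factor \<open>exp (c * s)\<close> leaves an integral that depends on \<open>s\<close> through its bounds only.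
  Continuity and the differential equation are read off from this form.
\<close>

lemma discounted_tail_eq:
  assumes "discountable c h" "0 \<le> s"
  shows "discounted_tail c h s = exp (c * s) *
    ((LINT r:{0..}|lborel. exp (- c * r) * h r) - (LINT r:{0..s}|lborel. exp (- c * r) * h r))"
proof -
  let ?p = "\<lambda>r. exp (- c * r) * h r"
  have "{0..} = {0..<s} \<union> {s..}" using assms by auto
  then have "(LINT r:{0..}|lborel. ?p r) = (LINT r:{0..<s} \<union> {s..}|lborel. ?p r)" by (simp only:)
  also have "\<dots> = (LINT r:{0..<s}|lborel. ?p r) + (LINT r:{s..}|lborel. ?p r)"
    by (intro set_integral_Un set_integrable_subset[OF assms(1)]) (use assms in auto)
  also have "(LINT r:{0..<s}|lborel. ?p r) = (LINT r:{0..s}|lborel. ?p r)"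
    by (rule set_integral_discrete_difference[where X="{s}"]) auto
  finally show ?thesis
    unfolding discounted_tail_def discount_shift by simp
qed

lemma discounted_tail_continuous:
  assumes "discountable c h" "0 < T"
  shows "continuous_on (horizon T 0) (discounted_tail c h)"
proof -
  have "continuous_on (horizon T 0) (\<lambda>s. exp (c * s) *
    ((LINT r:{0..}|lborel. exp (- c * r) * h r) - (LINT r:{0..s}|lborel. exp (- c * r) * h r)))"
    by (intro continuous_intros indefinite_integral_continuous_on assms
          set_integrable_subset[OF assms(1)]) auto
  then show ?thesis
    by (rule continuous_on_eq) (auto simp: discounted_tail_eq[OF assms(1)] horizon_def)
qed

lemma discounted_tail_has_derivative:
  assumes "discountable c h" "0 < T" "continuous_on (horizon T 0) h" "s \<in> horizon T 0"
  shows "(discounted_tail c h has_real_derivative c * discounted_tail c h s - h s)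
           (at s within horizon T 0)"
proof -
  have s: "0 \<le> s" using assms by (auto simp: horizon_def)
  have "((\<lambda>s. LINT r:{0..s}|lborel. exp (- c * r) * h r) has_real_derivative exp (- c * s) * h s)
     (at s within horizon T 0)"
    by (intro indefinite_integral_has_derivative assms continuous_intros)
  then have "((\<lambda>s. exp (c * s) *
    ((LINT r:{0..}|lborel. exp (- c * r) * h r) - (LINT r:{0..s}|lborel. exp (- c * r) * h r)))
    has_real_derivative c * discounted_tail c h s - h s) (at s within horizon T 0)"
    by (auto intro!: derivative_eq_intros simp: discounted_tail_eq[OF assms(1) s] exp_minus field_simps)
  then show ?thesis
    by (rule has_real_derivative_transform[OF assms(4), rotated])
       (simp add: discounted_tail_eq[OF assms(1)] horizon_def)
qed

lemma exp_discount_integral: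
  fixes c :: real
  assumes "0 < c"
  shows "set_integrable lborel {s..} (\<lambda>r. exp (- c * (r - s)))"
    and "(LINT r:{s..}|lborel. exp (- c * (r - s))) = 1 / c"
proof -
  have i: "((\<lambda>r. exp (- c * (r - s))) has_integral 1 / c) {s..}"
    using has_integral_mult_right[OF has_integral_exp_minus_to_infinity[OF assms, of s], of "exp (c * s)"]
    by (simp add: exp_diff exp_minus field_simps algebra_simps exp_add)
  have "(\<lambda>r. exp (- c * (r - s))) absolutely_integrable_on {s..}"
    by (rule nonnegative_absolutely_integrable_1) (use i in auto)
  then show si: "set_integrable lborel {s..} (\<lambda>r. exp (- c * (r - s)))"
    unfolding set_integrable_def by (subst (asm) integrable_completion) auto
  show "(LINT r:{s..}|lborel. exp (- c * (r - s))) = 1 / c"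
    using integral_unique[OF i] set_borel_integral_eq_integral(2)[OF si] by simp
qed

lemma bounded_imp_discountable:
  assumes "0 < c" "h \<in> borel_measurable borel" "\<And>r. 0 \<le> r \<Longrightarrow> \<bar>h r\<bar> \<le> B"
  shows "discountable c h"
proof (rule set_integrable_bound)
  show "set_integrable lborel {0..} (\<lambda>r. B * exp (- c * (r - 0)))"
    by (intro set_integrable_mult_right exp_discount_integral assms)
  show "set_borel_measurable lborel {0..} (\<lambda>r. exp (- c * r) * h r)"
    unfolding set_borel_measurable_def using assms(2) by measurable
  show "AE x in lborel. x \<in> {0..} \<longrightarrow> norm (exp (- c * x) * h x) \<le> norm (B * exp (- c * (x - 0)))"
  proof (intro AE_I2 impI)
    fix x :: real assume "x \<in> {0..}"
    then have "\<bar>h x\<bar> \<le> \<bar>B\<bar>" using assms(3)[of x] by simp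
    then show "norm (exp (- c * x) * h x) \<le> norm (B * exp (- c * (x - 0)))"
      by (simp add: abs_mult mult.commute mult_right_mono)
  qed
qed

lemma discounted_tail_const: "0 < c \<Longrightarrow> discounted_tail c (\<lambda>_. k) s = k / c"
  unfolding discounted_tail_def using exp_discount_integral(2)[of c s] by simp

lemma discounted_tail_mono:
  assumes "discountable c h" "discountable c g" "0 \<le> s" "\<And>r. s \<le> r \<Longrightarrow> h r \<le> g r"
  shows "discounted_tail c h s \<le> discounted_tail c g s"
  unfolding discounted_tail_def
  by (intro set_integral_mono discountable_tail_integrable assms mult_left_mono) (use assms in auto)

lemma discounted_tail_le:
  assumes "0 < c" "discountable c h" "0 \<le> s" "\<And>r. s \<le> r \<Longrightarrow> h r \<le> B"
  shows "discounted_tail c h s \<le> B / c"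
  using discounted_tail_mono[of c h "\<lambda>_. B" s] bounded_imp_discountable[of c "\<lambda>_. B" "\<bar>B\<bar>"] assms
  by (simp add: discounted_tail_const)

lemma discounted_tail_ge:
  assumes "0 < c" "discountable c h" "0 \<le> s" "\<And>r. s \<le> r \<Longrightarrow> B \<le> h r"
  shows "B / c \<le> discounted_tail c h s"
  using discounted_tail_mono[of c "\<lambda>_. B" h s] bounded_imp_discountable[of c "\<lambda>_. B" "\<bar>B\<bar>"] assms
  by (simp add: discounted_tail_const)

lemma discounted_tail_abs_le:
  assumes "0 < c" "discountable c h" "0 \<le> s" "\<And>r. s \<le> r \<Longrightarrow> \<bar>h r\<bar> \<le> B"
  shows "\<bar>discounted_tail c h s\<bar> \<le> B / c"
proof -
  have "h r \<le> B" "- B \<le> h r" if "s \<le> r" for r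
    using assms(4)[OF that] by (simp_all add: abs_le_iff)
  from discounted_tail_le[OF assms(1-3) this(1)] discounted_tail_ge[OF assms(1-3) this(2)]
  show ?thesis by (simp add: abs_le_iff)
qed

lemma discounted_tail_diff:
  assumes "discountable c h" "discountable c g" "0 \<le> s"
  shows "discountable c (\<lambda>r. h r - g r)"
    and "discounted_tail c h s - discounted_tail c g s = discounted_tail c (\<lambda>r. h r - g r) s"
  unfolding discounted_tail_def using assms discountable_tail_integrable[of c h] discountable_tail_integrable[of c g]
  by (simp_all add: right_diff_distrib)

text \<open>
  As for the tails, the kernel factorises, and the dependence on \<open>s\<close> becomes explicit.
\<close>

lemma state_eq:
  "state a w s x = exp (- a * s) * (x + (LINT r:{0..s}|lborel. exp (a * r) * w r))"
proof -
  have "exp (- a * (s - r)) * w r = exp (- a * s) * (exp (a * r) * w r)" for r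
    by (simp add: exp_diff exp_minus field_simps)
  then show ?thesis
    unfolding state_def by (simp only: set_integral_mult_right distrib_left)
qed

lemma set_integrable_exp_mult:
  fixes w :: "real \<Rightarrow> real"
  assumes "set_integrable lborel {0..s} w"
  shows "set_integrable lborel {0..s} (\<lambda>r. exp (a * r) * w r)"
proof (rule set_integrable_bound)
  show "set_integrable lborel {0..s} (\<lambda>r. exp (\<bar>a\<bar> * s) * w r)"
    using assms by simp
  show "set_borel_measurable lborel {0..s} (\<lambda>r. exp (a * r) * w r)"
    using assms unfolding set_integrable_def set_borel_measurable_def
    by (subst (asm) integrable_iff_bounded) (auto simp: mult.left_commute)
  show "AE r in lborel. r \<in> {0..s} \<longrightarrow> norm (exp (a * r) * w r) \<le> norm (exp (\<bar>a\<bar> * s) * w r)"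
  proof (intro AE_I2 impI)
    fix r assume "r \<in> {0..s}"
    then have "a * r \<le> \<bar>a\<bar> * s"
      by (intro order_trans[OF mult_right_mono[of a "\<bar>a\<bar>" r]] mult_left_mono) auto
    then show "norm (exp (a * r) * w r) \<le> norm (exp (\<bar>a\<bar> * s) * w r)"
      by (simp add: abs_mult mult_right_mono)
  qed
qed

lemma state_continuous:
  assumes "0 < T" "\<And>b. b \<in> horizon T 0 \<Longrightarrow> set_integrable lborel {0..b} w"
  shows "continuous_on (horizon T 0) (\<lambda>s. state a w s x)"
  unfolding state_eq
  by (intro continuous_intros indefinite_integral_continuous_on set_integrable_exp_mult assms)

lemma state_has_derivative:
  assumes "0 < T" "continuous_on (horizon T 0) w" "s \<in> horizon T 0"
  shows "((\<lambda>s. state a w s x) has_real_derivative - a * state a w s x + w s) (at s within horizon T 0)"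
proof -
  have "((\<lambda>s. LINT r:{0..s}|lborel. exp (a * r) * w r) has_real_derivative exp (a * s) * w s)
     (at s within horizon T 0)"
    by (intro indefinite_integral_has_derivative assms continuous_intros)
  then show ?thesis unfolding state_eq
    by (auto intro!: derivative_eq_intros simp: exp_minus field_simps)
qed

lemma state_0 [simp]: "state a w 0 x = x"
proof -
  have "(LINT r:{0..0}|lborel. exp (a * r) * w r) = (LINT r:{}|lborel. exp (a * r) * w r)"
    by (rule set_integral_discrete_difference[where X="{0}"]) auto
  then show ?thesis by (simp add: state_eq set_lebesgue_integral_def)
qed

text \<open>
  The level \<open>k\<close> is a rest point under the constant control \<open>a * k\<close>. Comparison with this state yields
  the bounds \<open>state_le\<close> and \<open>state_ge\<close>, which hold uniformly in time.
\<close>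

lemma state_const:
  assumes "0 \<le> s"
  shows "state a (\<lambda>_. a * k) s k = k"
proof -
  define d where "d = (\<lambda>s. state a (\<lambda>_. a * k) s k - k)"
  have "d s = exp (- a * s) * d 0"
  proof (rule linear_ode_solution[where T=\<infinity>])
    show "(d has_real_derivative - a * d s) (at s within horizon \<infinity> 0)" if "s \<in> horizon \<infinity> 0" for s
      unfolding d_def using that
      by (auto intro!: derivative_eq_intros state_has_derivative simp del: horizon_infinity simp: algebra_simps)
  qed (use assms in auto)
  then show ?thesis by (simp add: d_def)
qed

lemma state_mono:
  assumes "x \<le> x'" "set_integrable lborel {0..s} w" "set_integrable lborel {0..s} w'"
    "\<And>r. 0 \<le> r \<Longrightarrow> r \<le> s \<Longrightarrow> w r \<le> w' r"
  shows "state a w s x \<le> state a w' s x'"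
  unfolding state_eq
  by (intro mult_left_mono add_mono assms set_integral_mono set_integrable_exp_mult) (use assms in auto)

lemma state_diff:
  assumes "set_integrable lborel {0..s} w" "set_integrable lborel {0..s} w'"
  shows "state a w s x - state a w' s x' = state a (\<lambda>r. w r - w' r) s (x - x')"
  unfolding state_eq using assms[THEN set_integrable_exp_mult, of a]
  by (simp add: right_diff_distrib algebra_simps)

lemma set_integrable_const_Icc: "set_integrable lborel {a..b::real} (\<lambda>_. k::real)"
  by (intro borel_integrable_atLeastAtMost' continuous_intros)

lemma state_le:
  assumes "0 \<le> s" "x \<le> k" "set_integrable lborel {0..s} w" "\<And>r. 0 \<le> r \<Longrightarrow> r \<le> s \<Longrightarrow> w r \<le> a * k"
  shows "state a w s x \<le> k"
  using state_mono[OF assms(2,3) set_integrable_const_Icc assms(4), of a] state_const[OF assms(1)] by simp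

lemma state_ge:
  assumes "0 \<le> s" "k \<le> x" "set_integrable lborel {0..s} w" "\<And>r. 0 \<le> r \<Longrightarrow> r \<le> s \<Longrightarrow> a * k \<le> w r"
  shows "k \<le> state a w s x"
  using state_mono[OF assms(2) set_integrable_const_Icc assms(3,4), of a] state_const[OF assms(1)] by simp

section \<open>Uniqueness for the integro-differential equation\<close>

text \<open>
  Cutting \<open>q powr (- \<beta>)\<close> off after the horizon makes the costate a discounted tail over a half-line
  for finite and infinite \<open>T\<close> alike.
\<close>

definition source :: "real \<Rightarrow> ereal \<Rightarrow> (real \<Rightarrow> real) \<Rightarrow> real \<Rightarrow> real" where
  "source \<beta> T q r = indicator (horizon T 0) r * q r powr (- \<beta>)"

lemma source_nonneg: "0 \<le> source \<beta> T q r"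
  by (simp add: source_def)

lemma indicator_horizon_costate_integrand:
  assumes "0 \<le> s"
  shows "indicator (horizon T s) r *\<^sub>R costate_integrand \<delta> \<rho> \<beta> q s r
    = indicator {s..} r *\<^sub>R (exp (- (\<rho> + \<delta>) * (r - s)) * source \<beta> T q r)"
  using assms by (auto simp: source_def costate_integrand_def horizon_def indicator_def)

lemma costate_eq_tail: "0 \<le> s \<Longrightarrow> costate \<delta> \<rho> \<beta> T q s = discounted_tail (\<rho> + \<delta>) (source \<beta> T q) s"
  unfolding costate_def discounted_tail_def set_lebesgue_integral_def
  by (simp only: indicator_horizon_costate_integrand)

lemma costate_integrable_eq:
  "0 \<le> s \<Longrightarrow> set_integrable lborel (horizon T s) (costate_integrand \<delta> \<rho> \<beta> q s) \<longleftrightarrow>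
    set_integrable lborel {s..} (\<lambda>r. exp (- (\<rho> + \<delta>) * (r - s)) * source \<beta> T q r)"
  unfolding set_integrable_def by (simp only: indicator_horizon_costate_integrand)

lemma costate_nonneg: "0 \<le> costate \<delta> \<rho> \<beta> T q s"
  unfolding costate_def set_lebesgue_integral_def
  by (intro Bochner_Integration.integral_nonneg) (simp add: costate_integrand_def)

lemma source_continuous_on:
  assumes "continuous_on (horizon T 0) q" "\<And>s. s \<in> horizon T 0 \<Longrightarrow> 0 < q s"
  shows "continuous_on (horizon T 0) (source \<beta> T q)"
proof -
  have "continuous_on (horizon T 0) (\<lambda>s. q s powr (- \<beta>))"
    using assms(1) by (intro continuous_on_powr continuous_on_const ballI) (auto dest: assms(2))
  then show ?thesis by (rule continuous_on_eq) (simp add: source_def)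
qed

text \<open>
  Integrability of the tail at time 0 implies it at all later times, and the right-hand side is then
  automatically continuous; a solution therefore amounts to a positive function with the prescribed
  derivative.
\<close>

lemma ide_solution_iff:
  assumes "0 < T"
  shows "ide_solution \<delta> \<rho> \<beta> T y0 y \<longleftrightarrow>
    (\<forall>s\<in>horizon T 0. 0 < y s) \<and> discountable (\<rho> + \<delta>) (source \<beta> T y) \<and>
    (\<forall>s\<in>horizon T 0. (y has_real_derivative - \<delta> * y s + costate \<delta> \<rho> \<beta> T y s) (at s within horizon T 0)) \<and>
    y 0 = y0" (is "_ \<longleftrightarrow> ?R")
proof
  have 0: "0 \<in> horizon T 0" using assms by (auto simp: horizon_def zero_ereal_def)
  assume ide: "ide_solution \<delta> \<rho> \<beta> T y0 y"
  then have "set_integrable lborel (horizon T 0) (costate_integrand \<delta> \<rho> \<beta> y 0)"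
    using 0 unfolding ide_solution_def costate_integrand_def by blast
  then have "discountable (\<rho> + \<delta>) (source \<beta> T y)"
    by (simp add: costate_integrable_eq)
  with ide show ?R
    unfolding ide_solution_def costate_def costate_integrand_def by metis
next
  assume R: ?R
  have "continuous_on (horizon T 0) (\<lambda>s. - \<delta> * y s + discounted_tail (\<rho> + \<delta>) (source \<beta> T y) s)"
    using R by (intro continuous_intros discounted_tail_continuous assms DERIV_continuous_on) auto
  then have "continuous_on (horizon T 0) (\<lambda>s. - \<delta> * y s + costate \<delta> \<rho> \<beta> T y s)"
    by (rule continuous_on_eq) (auto simp: costate_eq_tail horizon_def)
  moreover have "set_integrable lborel (horizon T s) (costate_integrand \<delta> \<rho> \<beta> y s)"
    if "s \<in> horizon T 0" for s
  proof -
    have "0 \<le> s" using that by (simp add: horizon_def)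
    then show ?thesis
      unfolding costate_integrable_eq[OF \<open>0 \<le> s\<close>]
      by (intro discountable_tail_integrable) (use R in blast)
  qed
  ultimately show "ide_solution \<delta> \<rho> \<beta> T y0 y"
    using R unfolding ide_solution_def costate_integrand_def costate_def
    by (intro conjI exI[of _ "\<lambda>s. - \<delta> * y s + costate \<delta> \<rho> \<beta> T y s"])
       (auto simp: costate_integrand_def costate_def)
qed

lemma ide_solution_continuous:
  assumes "0 < T" "ide_solution \<delta> \<rho> \<beta> T y0 y"
  shows "continuous_on (horizon T 0) y"
  using assms by (auto simp: ide_solution_iff intro: DERIV_continuous_on)

lemma ide_costate_has_derivative:
  assumes "0 < T" "ide_solution \<delta> \<rho> \<beta> T y0 y" "s \<in> horizon T 0"
  shows "(costate \<delta> \<rho> \<beta> T y has_real_derivative (\<rho> + \<delta>) * costate \<delta> \<rho> \<beta> T y s - y s powr (- \<beta>))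
           (at s within horizon T 0)"
proof (rule has_real_derivative_transform[OF assms(3)])
  have s: "0 \<le> s" using assms by (auto simp: horizon_def)
  have "(discounted_tail (\<rho> + \<delta>) (source \<beta> T y) has_real_derivative
      (\<rho> + \<delta>) * discounted_tail (\<rho> + \<delta>) (source \<beta> T y) s - source \<beta> T y s) (at s within horizon T 0)"
    using assms ide_solution_continuous[OF assms(1,2)]
    by (intro discounted_tail_has_derivative source_continuous_on) (auto simp: ide_solution_iff)
  then show "(discounted_tail (\<rho> + \<delta>) (source \<beta> T y) has_real_derivative
      (\<rho> + \<delta>) * costate \<delta> \<rho> \<beta> T y s - y s powr (- \<beta>)) (at s within horizon T 0)"
    using assms(3) s by (simp add: costate_eq_tail source_def)
qed (auto simp: costate_eq_tail horizon_def)

lemma powr_neg_diff_sign: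
  fixes a b :: real
  assumes "0 < \<beta>" "0 < a" "0 < b"
  shows "(a - b) * (a powr (- \<beta>) - b powr (- \<beta>)) \<le> 0"
  using assms powr_mono2'[of "- \<beta>" a b] powr_mono2'[of "- \<beta>" b a]
  by (cases "a \<le> b") (auto intro: mult_nonpos_nonneg mult_nonneg_nonpos)

text \<open>
  The costate at time \<open>s\<close> sees the path after \<open>s\<close> only, and it sees it through a decreasing function.
\<close>

lemma costate_antimono:
  assumes "0 < \<beta>" "0 < T" "ide_solution \<delta> \<rho> \<beta> T y0 y" "ide_solution \<delta> \<rho> \<beta> T w0 w" "s \<in> horizon T 0"
    "\<And>r. r \<in> horizon T 0 \<Longrightarrow> s \<le> r \<Longrightarrow> w r \<le> y r"
  shows "costate \<delta> \<rho> \<beta> T y s \<le> costate \<delta> \<rho> \<beta> T w s"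
proof -
  have s: "0 \<le> s" using assms by (auto simp: horizon_def)
  have "source \<beta> T y r \<le> source \<beta> T w r" if "s \<le> r" for r
    using assms that by (auto simp: source_def indicator_def ide_solution_iff intro!: powr_mono2')
  then show ?thesis
    using assms s by (auto simp: costate_eq_tail ide_solution_iff intro!: discounted_tail_mono)
qed

lemma nonzero_on_interval_same_sign:
  fixes f :: "real \<Rightarrow> real"
  assumes "continuous_on {a..b} f" "a \<le> b" "0 < f a" "\<And>s. a \<le> s \<Longrightarrow> s \<le> b \<Longrightarrow> f s \<noteq> 0"
  shows "0 < f b"
  using IVT2'[of f b 0 a] assms by (metis less_eq_real_def linorder_not_less)

text \<open>
  The proof studies \<open>D = e\<^sup>-\<^sup>\<rho>\<^sup>s (y - w) (z - v)\<close>. The discount is the one for which the mixed terms of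
  its derivative cancel, leaving a sum of two nonnegative terms.
\<close>

theorem ide_solution_unique:
  assumes par: "0 < \<beta>" "0 < T"
    and y: "ide_solution \<delta> \<rho> \<beta> T y0 y" and w: "ide_solution \<delta> \<rho> \<beta> T y0 w"
    and s: "s \<in> horizon T 0"
  shows "w s = y s"
proof -
  define A where "A = horizon T 0"
  define z where "z = costate \<delta> \<rho> \<beta> T y"
  define v where "v = costate \<delta> \<rho> \<beta> T w"
  define D where "D = (\<lambda>s. exp (- \<rho> * s) * ((y s - w s) * (z s - v s)))"
  define D' where "D' = (\<lambda>s. exp (- \<rho> * s) *
      ((z s - v s)\<^sup>2 - (y s - w s) * (y s powr (- \<beta>) - w s powr (- \<beta>))))"
  have pos: "0 < y r" "0 < w r" if "r \<in> A" for r
    using y w that par by (auto simp: ide_solution_iff A_def)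
  have dy: "(y has_real_derivative - \<delta> * y r + z r) (at r within A)"
    and dw: "(w has_real_derivative - \<delta> * w r + v r) (at r within A)" if "r \<in> A" for r
    using y w that par by (auto simp: ide_solution_iff A_def z_def v_def)
  have dz: "(z has_real_derivative (\<rho> + \<delta>) * z r - y r powr (- \<beta>)) (at r within A)"
    and dv: "(v has_real_derivative (\<rho> + \<delta>) * v r - w r powr (- \<beta>)) (at r within A)" if "r \<in> A" for r
    using ide_costate_has_derivative[OF par(2) y] ide_costate_has_derivative[OF par(2) w] that
    by (auto simp: A_def z_def v_def)
  have dD: "(D has_real_derivative D' r) (at r within A)" if "r \<in> A" for r
    unfolding D_def D'_def
    by (rule derivative_eq_intros dy dw dz dv that refl)+ (simp add: algebra_simps power2_eq_square)
  have D'_nonneg: "0 \<le> D' r" if "r \<in> A" for r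
    using powr_neg_diff_sign[OF par(1) pos[OF that]]
    unfolding D'_def by (intro mult_nonneg_nonneg) (auto intro: order_trans[OF _ zero_le_power2])
  have sub: "{0..b} \<subseteq> A" if "b \<in> A" for b
    using that horizon_Icc unfolding A_def by blast
  have cD: "continuous_on {a..b} D" if "0 \<le> a" "b \<in> A" for a b
    by (rule continuous_on_subset[OF DERIV_continuous_on[OF dD]]) (use sub[OF that(2)] that in auto)
  have D_mono: "D a \<le> D b" if "0 \<le> a" "a \<le> b" "b \<in> A" for a b
  proof (rule DERIV_nonneg_imp_increasing_open[OF that(2) _ cD[OF that(1,3)]])
    fix r assume r: "a < r" "r < b"
    then have "r \<in> A" using sub[OF that(3)] that by auto
    with r that show "\<exists>d. (D has_real_derivative d) (at r) \<and> 0 \<le> d"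
      using horizon_Ioo_DERIV[of D "D' r" r T b] dD[of r] D'_nonneg[of r] unfolding A_def by auto
  qed
  have D0: "D 0 = 0"
    using y w par by (simp add: D_def ide_solution_iff)
  have D_nonpos: "D r \<le> 0" if r: "r \<in> A" for r
  proof (rule ccontr)
    assume "\<not> D r \<le> 0"
    then have Dpos: "0 < D b" if "b \<in> A" "r \<le> b" for b
      using D_mono[of r b] that r by (auto simp: A_def horizon_def)
    have r0: "0 \<le> r" using r by (auto simp: A_def horizon_def)
    \<comment> \<open>While \<open>D\<close> is positive, \<open>y - w\<close> cannot vanish, so by continuity it keeps its sign after \<open>r\<close>.\<close>
    have cts: "continuous_on {r..b} (\<lambda>s. y s - w s)" if "b \<in> A" for b
    proof (rule continuous_on_subset[of A])
      show "continuous_on A (\<lambda>s. y s - w s)"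
        using DERIV_continuous_on[OF dy] DERIV_continuous_on[OF dw] by (rule continuous_on_diff)
      show "{r..b} \<subseteq> A" using sub[OF that] r0 by auto
    qed
    have nz: "y b - w b \<noteq> 0" if "b \<in> A" "r \<le> b" for b
      using Dpos[OF that] unfolding D_def by auto
    have in_A: "u \<in> A" if "r \<le> u" "u \<le> b" "b \<in> A" for u b
      using sub[OF that(3)] that r0 by auto
    show False
    proof (cases "y r - w r > 0")
      case True
      have "0 < y b - w b" if "b \<in> A" "r \<le> b" for b
        using nonzero_on_interval_same_sign[OF cts[OF that(1)] that(2) True] nz in_A that by blast
      then have "z r \<le> v r"
        unfolding z_def v_def
        by (intro costate_antimono[OF par y w]) (use r in \<open>auto simp: A_def intro: less_imp_le\<close>)
      then have "D r \<le> 0"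
        using True unfolding D_def by (intro mult_nonneg_nonpos[OF exp_ge_zero]) (auto intro: mult_nonneg_nonpos)
      with Dpos[OF r] show False by simp
    next
      case False
      with nz[OF r] have neg: "0 < - (y r - w r)" by simp
      have "0 < - (y b - w b)" if "b \<in> A" "r \<le> b" for b
      proof (rule nonzero_on_interval_same_sign[OF continuous_on_minus[OF cts[OF that(1)]] that(2) neg])
        show "- (y u - w u) \<noteq> 0" if "r \<le> u" "u \<le> b" for u
          using nz[OF in_A[OF that \<open>b \<in> A\<close>] that(1)] by simp
      qed
      then have "v r \<le> z r"
        unfolding z_def v_def
        by (intro costate_antimono[OF par w y]) (use r in \<open>auto simp: A_def intro: less_imp_le\<close>)
      then have "D r \<le> 0"
        using neg unfolding D_def by (intro mult_nonneg_nonpos[OF exp_ge_zero]) (auto intro: mult_nonpos_nonneg)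
      with Dpos[OF r] show False by simp
    qed
  qed
  have D_zero: "D r = 0" if "r \<in> A" for r
    using D_nonpos[OF that] D_mono[of 0 r] D0 that by (auto simp: A_def horizon_def)
  \<comment> \<open>Both terms of the derivative of \<open>D\<close> vanish; the square among them gives equality of the costates.
    Interior times are used because two-sided derivatives are unique.\<close>
  have z_eq: "z r = v r" if r: "0 < r" "r < b" "b \<in> A" for r b
  proof -
    have rA: "r \<in> A" using sub[OF r(3)] r by auto
    have "(D has_real_derivative D' r) (at r)"
      using horizon_Ioo_DERIV[of D "D' r" r T b] dD[OF rA] r unfolding A_def by auto
    moreover have "(D has_real_derivative 0) (at r)"
    proof (rule has_field_derivative_transform_within_open[where f="\<lambda>_. 0" and S="{0<..<b}"])
      show "0 = D x" if "x \<in> {0<..<b}" for x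
        using D_zero[OF subsetD[OF sub[OF r(3)]], of x] that by simp
    qed (use r in auto)
    ultimately have "D' r = 0" by (rule DERIV_unique)
    then have "(z r - v r)\<^sup>2 \<le> 0"
      using powr_neg_diff_sign[OF par(1) pos[OF rA]] unfolding D'_def by simp
    then show ?thesis by simp
  qed
  show "w s = y s"
  proof (cases "s = 0")
    case True
    then show ?thesis using y w par by (simp add: ide_solution_iff)
  next
    case False
    with s have s0: "0 < s" and sA: "s \<in> A" by (auto simp: A_def horizon_def)
    \<comment> \<open>With equal costates, \<open>y - w\<close> solves the homogeneous equation and starts at 0.\<close>
    define f where "f = (\<lambda>r. exp (\<delta> * r) * (y r - w r))"
    have df: "(f has_real_derivative exp (\<delta> * r) * (z r - v r)) (at r within A)" if "r \<in> A" for r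
      unfolding f_def by (rule derivative_eq_intros dy dw that refl)+ (simp add: algebra_simps)
    have "f s = f 0"
    proof (rule DERIV_isconst_end[OF s0])
      show "continuous_on {0..s} f"
        by (rule continuous_on_subset[OF DERIV_continuous_on[OF df] sub[OF sA]])
      show "DERIV f r :> 0" if "0 < r" "r < s" for r
      proof -
        have "r \<in> A" using sub[OF sA] that by auto
        from df[OF this] have "(f has_real_derivative 0) (at r within horizon T 0)"
          by (simp add: z_eq[OF that sA] A_def)
        then show ?thesis by (rule horizon_Ioo_DERIV[OF _ that s])
      qed
    qed
    moreover have "f 0 = 0" using y w par by (simp add: f_def ide_solution_iff)
    ultimately show ?thesis by (simp add: f_def)
  qed
qed

section \<open>Existence for the integro-differential equation\<close>

text \<open>
  For a continuous control \<open>w\<close> the state with rate \<open>a\<close> is bounded by \<open>sup \<bar>w\<bar> / a\<close> once the initial state is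
  subtracted, and a tail with rate \<open>c\<close> is bounded by \<open>sup \<bar>h\<bar> / c\<close>. The composition therefore has norm at
  most \<open>1 / (a * c)\<close>, and an \<open>M\<close>-Lipschitz operator \<open>H\<close> with \<open>M < a * c\<close> yields a contraction. The operator is
  allowed to be nonlocal, which is used for finite horizons; the assumption \<open>low\<close> makes the
  closed set of paths above \<open>l\<close> invariant.
\<close>

lemma discounted_state_fixed_point:
  fixes H :: "(real \<Rightarrow>\<^sub>C real) \<Rightarrow> real \<Rightarrow> real"
  assumes par: "0 < a" "0 < c" "0 \<le> M" "M < a * c" "l \<le> x"
    and meas: "\<And>y. H y \<in> borel_measurable borel"
    and bdd: "\<And>y. \<exists>B. \<forall>r\<ge>0. \<bar>H y r\<bar> \<le> B"
    and lip: "\<And>(y :: real \<Rightarrow>\<^sub>C real) v r. 0 \<le> r \<Longrightarrow> \<bar>H y r - H v r\<bar> \<le> M * dist y v"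
    and low: "\<And>y r. (\<And>s. l \<le> apply_bcontfun y s) \<Longrightarrow> 0 \<le> r \<Longrightarrow> a * c * l \<le> H y r"
  obtains y where "\<And>s. l \<le> apply_bcontfun y s"
    "\<And>s. 0 \<le> s \<Longrightarrow> apply_bcontfun y s = state a (discounted_tail c (H y)) s x"
proof -
  define W where "W y = discounted_tail c (H y)" for y
  \<comment> \<open>Bounded continuous functions live on the whole real line; before time 0 the image is
    constant, equal to the initial state.\<close>
  define \<Phi> where "\<Phi> y = Bcontfun (\<lambda>s. state a (W y) (max 0 s) x)" for y
  define S where "S = PiC UNIV (\<lambda>_::real. {l..})"
  have S: "y \<in> S \<longleftrightarrow> (\<forall>s. l \<le> apply_bcontfun y s)" for y
    by (auto simp: S_def mem_PiC_iff)
  have disc: "discountable c (H y)" for y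
    using bdd[of y] bounded_imp_discountable[OF par(2) meas] by blast
  have W_cont: "continuous_on {0..} (W y)" for y
    using discounted_tail_continuous[OF disc, of \<infinity> y] by (simp add: W_def)
  have W_int: "set_integrable lborel {0..b} (W y)" for b y
    by (intro borel_integrable_atLeastAtMost' continuous_on_subset[OF W_cont]) auto
  have \<Phi>: "apply_bcontfun (\<Phi> y) = (\<lambda>s. state a (W y) (max 0 s) x)" for y
  proof -
    have c: "continuous_on UNIV (\<lambda>s. state a (W y) (max 0 s) x)"
      using state_continuous[of \<infinity> "W y" a x] W_int
      by (intro continuous_on_compose2[where f="\<lambda>s. max 0 s" and g="\<lambda>s. state a (W y) s x" and t="{0..}"])
         (auto intro!: continuous_intros)
    obtain B where B: "\<And>r. 0 \<le> r \<Longrightarrow> \<bar>H y r\<bar> \<le> B" using bdd by blast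
    \<comment> \<open>A level that the state cannot leave: \<open>- k \<le> x \<le> k\<close>, and the control stays between \<open>- a * k\<close> and \<open>a * k\<close>.\<close>
    define k where "k = max \<bar>x\<bar> (B / (c * a))"
    have Bk: "B / c \<le> a * k"
    proof -
      have "B / c = a * (B / (c * a))" using par by simp
      also have "\<dots> \<le> a * k" using par by (intro mult_left_mono) (auto simp: k_def)
      finally show ?thesis .
    qed
    have Wle: "W y r \<le> a * k" "a * (- k) \<le> W y r" if "0 \<le> r" for r
    proof -
      have "\<bar>W y r\<bar> \<le> B / c"
        unfolding W_def using order_trans[OF that] B
        by (intro discounted_tail_abs_le[OF par(2) disc that]) blast
      with Bk show "W y r \<le> a * k" "a * (- k) \<le> W y r" by simp_all
    qed
    have "norm (state a (W y) (max 0 s) x) \<le> k" for s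
    proof -
      have "state a (W y) (max 0 s) x \<le> k"
        by (intro state_le W_int Wle) (auto simp: k_def)
      moreover have "- k \<le> state a (W y) (max 0 s) x"
        by (intro state_ge W_int Wle) (auto simp: k_def)
      ultimately show ?thesis by simp
    qed
    with c have "(\<lambda>s. state a (W y) (max 0 s) x) \<in> bcontfun"
      by (rule bcontfun_normI)
    then show ?thesis unfolding \<Phi>_def by (rule Bcontfun_inverse)
  qed
  have "\<exists>!y. y \<in> S \<and> \<Phi> y = y"
  proof (rule Banach_fix)
    show "Topological_Spaces.complete S"
      unfolding S_def by (intro closed_PiC complete_eq_closed[THEN iffD2]) auto
    have "const_bcontfun x \<in> S" using par by (simp add: S)
    then show "S \<noteq> {}" by blast
    show "0 \<le> M / (a * c)" "M / (a * c) < 1" using par by simp_all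
    show "\<Phi> ` S \<subseteq> S"
    proof safe
      fix y assume "y \<in> S"
      then have "a * l \<le> W y r" if "0 \<le> r" for r
        using discounted_tail_ge[OF par(2) disc that low[of y]] that par S
        unfolding W_def by simp
      then show "\<Phi> y \<in> S"
        unfolding S \<Phi> by (intro allI state_ge W_int par) auto
    qed
    show "dist (\<Phi> y) (\<Phi> v) \<le> M / (a * c) * dist y v" if "y \<in> S" "v \<in> S" for y v
    proof (rule dist_bound)
      fix s
      define k where "k = M / (a * c) * dist y v"
      have one_sided: "state a (W y) (max 0 s) x - state a (W v) (max 0 s) x \<le> M / (a * c) * dist y v" for y v
      proof -
        have "W y r - W v r \<le> a * (M / (a * c) * dist y v)" if "0 \<le> r" for r
        proof -
          have "W y r - W v r \<le> (M * dist y v) / c"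
            unfolding W_def discounted_tail_diff(2)[OF disc disc that]
            by (rule discounted_tail_le[OF par(2) discounted_tail_diff(1)[OF disc disc that] that])
               (use lip order_trans[OF that] in \<open>auto simp: abs_le_iff\<close>)
          then show ?thesis using par by simp
        qed
        then show ?thesis
          unfolding state_diff[OF W_int W_int]
          by (intro state_le set_integral_diff W_int) (use par in auto)
      qed
      show "dist (apply_bcontfun (\<Phi> y) s) (apply_bcontfun (\<Phi> v) s) \<le> M / (a * c) * dist y v"
        using one_sided[of y v] one_sided[of v y] unfolding \<Phi> dist_real_def
        by (simp add: abs_le_iff dist_commute)
    qed
  qed
  then obtain y where y: "y \<in> S" "\<Phi> y = y" by blast
  have "apply_bcontfun y s = state a (discounted_tail c (H y)) s x" if "0 \<le> s" for s
    using fun_cong[OF \<Phi>[of y], of s] that by (simp add: y W_def)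
  with y(1) S that show ?thesis by blast
qed

lemma powr_neg_lipschitz:
  fixes u v :: real
  assumes "0 < m" "m \<le> u" "u \<le> v" "0 < \<beta>"
  shows "u powr (- \<beta>) - v powr (- \<beta>) \<le> \<beta> * m powr (- \<beta> - 1) * (v - u)"
proof (cases "u = v")
  case False
  with assms have "u < v" by simp
  have "\<exists>z. u < z \<and> z < v \<and> v powr (- \<beta>) - u powr (- \<beta>) = (v - u) * (- \<beta> * z powr (- \<beta> - 1))"
    by (rule MVT2[OF \<open>u < v\<close>]) (use assms in \<open>auto intro!: derivative_eq_intros\<close>)
  then obtain z where z: "u < z" "v powr (- \<beta>) - u powr (- \<beta>) = (v - u) * (- \<beta> * z powr (- \<beta> - 1))"
    by blast
  have "z powr (- \<beta> - 1) \<le> m powr (- \<beta> - 1)"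
    using z assms by (intro powr_mono2') auto
  then have "(v - u) * (\<beta> * z powr (- \<beta> - 1)) \<le> (v - u) * (\<beta> * m powr (- \<beta> - 1))"
    using assms by (intro mult_left_mono) auto
  with z(2) show ?thesis by (simp add: algebra_simps)
qed simp

text \<open>
  The truncated power is nonincreasing, but becomes nondecreasing once a multiple of the identity
  beyond its Lipschitz constant is added.
\<close>

lemma truncated_powr_bounds:
  fixes u v :: real
  assumes "0 < m" "0 < \<beta>" "u \<le> v" and M: "\<beta> * m powr (- \<beta> - 1) \<le> M"
  shows "max v m powr (- \<beta>) \<le> max u m powr (- \<beta>)"
    and "max u m powr (- \<beta>) + M * u \<le> max v m powr (- \<beta>) + M * v"
proof -
  show "max v m powr (- \<beta>) \<le> max u m powr (- \<beta>)"
    using assms by (intro powr_mono2') auto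
  have "max u m powr (- \<beta>) - max v m powr (- \<beta>) \<le> \<beta> * m powr (- \<beta> - 1) * (max v m - max u m)"
    using assms by (intro powr_neg_lipschitz) auto
  also have "\<dots> \<le> M * (v - u)"
    using assms by (intro mult_mono M) (auto intro: order_trans[OF _ M])
  finally show "max u m powr (- \<beta>) + M * u \<le> max v m powr (- \<beta>) + M * v"
    by (simp add: algebra_simps)
qed

text \<open>
  With \<open>w\<close> the tail of the shifted right-hand side and \<open>y\<close> the state with rate \<open>a\<close> and control \<open>w\<close>, the
  function \<open>z = w - (a - \<delta>) * y\<close> satisfies \<open>y' = - \<delta> * y + z\<close> and the costate equation
  \<open>z' = (\<rho> + \<delta>) * z - max y m powr (- \<beta>)\<close>. It remains to see that \<open>z\<close> is the costate, not merely one of the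
  solutions of this equation; they differ by multiples of \<open>exp ((\<rho> + \<delta>) * s)\<close>, and the condition at the end
  of the horizon excludes these.
\<close>

lemma truncated_ide_solution:
  assumes par: "0 < \<delta>" "0 < \<rho>" "0 < \<beta>" "0 < T" "0 < m" "0 \<le> l" "l \<le> x"
    and low: "\<delta> * (\<rho> + \<delta>) * l \<le> max l m powr (- \<beta>)" and inf: "T = \<infinity> \<or> l = 0"
  defines "src \<equiv> \<lambda>y r. indicator (horizon T 0) r * max (y r) m powr (- \<beta>)"
  obtains y :: "real \<Rightarrow> real" where "y 0 = x" "\<And>s. l \<le> y s" "discountable (\<rho> + \<delta>) (src y)"
    "\<And>s. s \<in> horizon T 0 \<Longrightarrow>
       (y has_real_derivative - \<delta> * y s + discounted_tail (\<rho> + \<delta>) (src y) s) (at s within horizon T 0)"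
proof -
  \<comment> \<open>The Lipschitz constant of the truncated power is \<open>k - 1\<close>. Choosing the shift \<open>k\<close> of the rate first
    avoids solving a quadratic equation: \<open>M\<close> is what the shift produces, and \<open>M \<ge> k\<close>.\<close>
  define k where "k = 1 + \<beta> * m powr (- \<beta> - 1)"
  define a where "a = \<delta> + k"
  define c where "c = \<rho> + a"
  define M where "M = k * (c + \<delta>)"
  have k: "1 \<le> k" using par by (simp add: k_def)
  have pos: "0 < a" "0 < c" "0 < M" using par k by (auto simp: a_def c_def M_def)
  have Ml: "\<beta> * m powr (- \<beta> - 1) \<le> M"
  proof -
    have "k * 1 \<le> k * (c + \<delta>)"
      using par k by (intro mult_left_mono) (auto simp: c_def a_def)
    then show ?thesis by (simp add: M_def k_def)
  qed
  have ac: "a * c = M + \<delta> * (\<rho> + \<delta>)"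
    by (simp add: a_def c_def M_def algebra_simps)
  have kc: "k * c \<le> M" using par k by (simp add: M_def)
  define G where "G t = max t m powr (- \<beta>) + M * t" for t
  \<comment> \<open>After a finite horizon the value \<open>k * c * y T\<close> is prescribed: its tail with rate \<open>c\<close> is \<open>k * y T\<close>, so that \<open>z\<close>
    vanishes at \<open>T\<close>, as the costate must. The Lipschitz constant is not increased since \<open>k * c \<le> M\<close>.\<close>
  define H where "H y r = (if ereal r \<le> T then G (y r) else k * c * y (real_of_ereal T))"
    for y :: "real \<Rightarrow>\<^sub>C real" and r
  have G_lip: "\<bar>G u - G v\<bar> \<le> M * \<bar>u - v\<bar>" for u v
    using truncated_powr_bounds[OF par(5,3) _ Ml, of u v] truncated_powr_bounds[OF par(5,3) _ Ml, of v u]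
    unfolding G_def by (cases "u \<le> v") (auto simp: abs_if algebra_simps)
  have G_mono: "G u \<le> G v" if "u \<le> v" for u v
    using truncated_powr_bounds(2)[OF par(5,3) that Ml] by (simp add: G_def)
  have G_cont: "continuous_on UNIV G"
    unfolding G_def using par by (intro continuous_intros) auto
  have G_bound: "\<bar>G t\<bar> \<le> m powr (- \<beta>) + M * B" if "\<bar>t\<bar> \<le> B" for t B
  proof -
    have "max t m powr (- \<beta>) \<le> m powr (- \<beta>)" using par by (intro powr_mono2') auto
    moreover have "\<bar>M * t\<bar> \<le> M * B" using pos that by (simp add: abs_mult)
    moreover have "0 \<le> max t m powr (- \<beta>)" by simp
    ultimately show ?thesis unfolding G_def by linarith
  qed
  have H_bound: "\<exists>B. \<forall>r\<ge>0. \<bar>H y r\<bar> \<le> B" for y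
  proof -
    obtain B where "\<And>s. \<bar>y s\<bar> \<le> B"
      using bounded_apply_bcontfun[of y] by (auto simp: bounded_iff)
    then have "\<bar>H y r\<bar> \<le> max (m powr (- \<beta>) + M * B) (\<bar>k * c\<bar> * B)" for r
      using G_bound[of "y r" B] unfolding H_def
      by (simp add: abs_mult mult_left_mono max.coboundedI1 max.coboundedI2)
    then show ?thesis by blast
  qed
  have H_meas: "H y \<in> borel_measurable borel" for y
  proof -
    have [measurable]: "apply_bcontfun y \<in> borel_measurable borel" "G \<in> borel_measurable borel"
      by (auto intro!: borel_measurable_continuous_onI G_cont)
    show ?thesis unfolding H_def by measurable
  qed
  obtain Y where Y: "\<And>s. l \<le> apply_bcontfun Y s"
    "\<And>s. 0 \<le> s \<Longrightarrow> apply_bcontfun Y s = state a (discounted_tail c (H Y)) s x"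
  proof (rule discounted_state_fixed_point[of a c M l x H])
    show "M < a * c" using par by (simp add: ac)
    show "\<bar>H y r - H v r\<bar> \<le> M * dist y v" for y v :: "real \<Rightarrow>\<^sub>C real" and r
    proof -
      have d: "\<bar>y s - v s\<bar> \<le> dist y v" for s
        using dist_bounded[of y s v] by (simp add: dist_real_def)
      have "M * \<bar>y r - v r\<bar> \<le> M * dist y v" using d pos by simp
      moreover have "k * c * \<bar>y (real_of_ereal T) - v (real_of_ereal T)\<bar> \<le> M * dist y v"
        using d pos kc by (intro mult_mono) auto
      moreover have "\<bar>k * c * y (real_of_ereal T) - k * c * v (real_of_ereal T)\<bar>
          = k * c * \<bar>y (real_of_ereal T) - v (real_of_ereal T)\<bar>"
        using k pos by (simp add: right_diff_distrib[symmetric] abs_mult)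
      ultimately show ?thesis
        using G_lip[of "y r" "v r"] unfolding H_def by (simp split: if_split)
    qed
    show "a * c * l \<le> H y r" if y: "\<And>s. l \<le> apply_bcontfun y s" and r: "0 \<le> r" for y r
    proof (cases "ereal r \<le> T")
      case True
      have "a * c * l \<le> G l" using low by (simp add: ac G_def algebra_simps)
      also have "\<dots> \<le> G (y r)" by (rule G_mono[OF y])
      finally show ?thesis using True by (simp add: H_def)
    next
      case False
      with inf have "l = 0" by auto
      with False y[of "real_of_ereal T"] k pos show ?thesis by (simp add: H_def)
    qed
  qed (use pos par H_meas H_bound in auto)
  define y where "y = apply_bcontfun Y"
  define A where "A = horizon T 0"
  define w where "w = discounted_tail c (H Y)"
  define z where "z s = w s - k * y s" for s
  define Z where "Z = discounted_tail (\<rho> + \<delta>) (src y)"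
  have y_cont: "continuous_on S y" for S by (simp add: y_def)
  obtain B where B: "\<And>r. 0 \<le> r \<Longrightarrow> \<bar>H Y r\<bar> \<le> B" using H_bound[of Y] by blast
  have disc: "discountable c (H Y)"
    by (rule bounded_imp_discountable[OF pos(2) H_meas B])
  have w_cont: "continuous_on A w"
    unfolding w_def A_def by (rule discounted_tail_continuous[OF disc par(4)])
  have A_nn: "0 \<le> s" if "s \<in> A" for s using that by (simp add: A_def horizon_def)
  have dy: "(y has_real_derivative - a * y s + w s) (at s within A)" if "s \<in> A" for s
    unfolding A_def
  proof (rule has_real_derivative_transform)
    show "((\<lambda>s. state a w s x) has_real_derivative - a * y s + w s) (at s within horizon T 0)"
      using state_has_derivative[OF par(4), of w s a x] w_cont that Y(2)[OF A_nn[OF that]]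
      by (simp add: A_def y_def w_def)
  qed (use that Y(2) A_nn in \<open>auto simp: A_def y_def w_def\<close>)
  have H_eq: "H Y s = G (y s)" if "s \<in> A" for s
    using that by (simp add: H_def y_def A_def horizon_def)
  have "continuous_on A (\<lambda>s. G (y s))"
    by (rule continuous_on_compose2[OF G_cont y_cont]) auto
  then have "continuous_on A (H Y)"
    by (rule continuous_on_eq) (simp add: H_eq)
  then have dw: "(w has_real_derivative c * w s - G (y s)) (at s within A)" if "s \<in> A" for s
    using discounted_tail_has_derivative[OF disc par(4), of s] that
    by (simp add: A_def w_def H_eq[symmetric])
  have dz: "(z has_real_derivative (\<rho> + \<delta>) * z s - max (y s) m powr (- \<beta>)) (at s within A)" if "s \<in> A" for s
    unfolding z_def
    by (rule derivative_eq_intros dy dw that refl)+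
       (simp add: G_def M_def c_def a_def algebra_simps)
  have src_bound: "\<bar>src y r\<bar> \<le> m powr (- \<beta>)" for r
    using powr_mono2'[of "- \<beta>" m "max (y r) m"] par by (auto simp: src_def indicator_def)
  have src_cont: "continuous_on A (src y)"
  proof -
    have "continuous_on A (\<lambda>r. max (y r) m powr (- \<beta>))"
      using par by (intro continuous_intros y_cont) auto
    then show ?thesis by (rule continuous_on_eq) (simp add: src_def A_def)
  qed
  have src_disc: "discountable (\<rho> + \<delta>) (src y)"
  proof (rule bounded_imp_discountable[OF _ _ src_bound])
    have [measurable]: "y \<in> borel_measurable borel"
      by (auto intro!: borel_measurable_continuous_onI y_cont)
    have [measurable]: "horizon T 0 \<in> sets borel" unfolding horizon_def by measurable
    show "src y \<in> borel_measurable borel" unfolding src_def by measurable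
  qed (use par in auto)
  have dZ: "(Z has_real_derivative (\<rho> + \<delta>) * Z s - max (y s) m powr (- \<beta>)) (at s within A)" if "s \<in> A" for s
    using discounted_tail_has_derivative[OF src_disc par(4), of s] src_cont that
    by (simp add: A_def Z_def src_def)
  have diff: "z s - Z s = exp ((\<rho> + \<delta>) * s) * (z 0 - Z 0)" if "s \<in> A" for s
  proof (rule linear_ode_solution[where T=T])
    show "((\<lambda>s. z s - Z s) has_real_derivative (\<rho> + \<delta>) * (z r - Z r)) (at r within horizon T 0)"
      if "r \<in> horizon T 0" for r
      using dz[of r] dZ[of r] that unfolding A_def
      by (auto intro!: derivative_eq_intros simp: algebra_simps)
  qed (use that in \<open>simp add: A_def\<close>)
  have z0: "z 0 = Z 0"
  proof (cases T)
    case (real t)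
    then have tA: "t \<in> A" using par by (simp add: A_def)
    have "Z t = (LINT r:{t..}|lborel. 0)"
      unfolding Z_def discounted_tail_def set_lebesgue_integral_def
      by (rule integral_discrete_difference[where X="{t}"]) (auto simp: src_def real indicator_def)
    moreover have "w t = (LINT r:{t..}|lborel. exp (- c * (r - t)) * (k * c * y t))"
      unfolding w_def discounted_tail_def set_lebesgue_integral_def
      by (rule integral_discrete_difference[where X="{t}"]) (auto simp: H_def y_def real indicator_def)
    then have "w t = k * y t"
      using discounted_tail_const[OF pos(2), of "k * c * y t" t] pos by (simp add: discounted_tail_def)
    ultimately have "z t - Z t = 0" by (simp add: z_def)
    with diff[OF tA] show ?thesis by simp
  next
    case PInf
    obtain K where K: "\<And>s. \<bar>y s\<bar> \<le> K"
      using bounded_apply_bcontfun[of Y] by (auto simp: bounded_iff y_def)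
    \<comment> \<open>A bounded multiple of a growing exponential is zero.\<close>
    define L where "L = B / c + k * K + m powr (- \<beta>) / (\<rho> + \<delta>)"
    have bound: "\<bar>z s - Z s\<bar> \<le> L" if "0 \<le> s" for s
    proof -
      have "\<bar>w s\<bar> \<le> B / c"
        unfolding w_def using order_trans[OF that] B
        by (intro discounted_tail_abs_le[OF pos(2) disc that]) blast
      moreover have "\<bar>Z s\<bar> \<le> m powr (- \<beta>) / (\<rho> + \<delta>)"
        unfolding Z_def using par src_bound
        by (intro discounted_tail_abs_le[OF _ src_disc that]) auto
      moreover have "\<bar>k * y s\<bar> \<le> k * K" using K k by (simp add: abs_mult)
      ultimately show ?thesis unfolding z_def L_def by (simp add: abs_le_iff)
    qed
    have "((\<lambda>s. L * exp (- (\<rho> + \<delta>) * s)) \<longlongrightarrow> 0) at_top"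
    proof (rule tendsto_mult_right_zero, rule filterlim_compose[OF exp_at_bot])
      show "filterlim (\<lambda>s. - (\<rho> + \<delta>) * s) at_bot at_top"
        using par by (intro filterlim_tendsto_neg_mult_at_bot[OF tendsto_const] filterlim_ident) auto
    qed
    moreover have "eventually (\<lambda>s. \<bar>z 0 - Z 0\<bar> \<le> L * exp (- (\<rho> + \<delta>) * s)) at_top"
      using eventually_ge_at_top[of 0]
    proof eventually_elim
      case (elim s)
      have "z 0 - Z 0 = exp (- (\<rho> + \<delta>) * s) * (z s - Z s)"
        using diff[of s] elim PInf
        by (simp add: A_def mult.assoc[symmetric] exp_add[symmetric]) (simp add: algebra_simps)
      then have "\<bar>z 0 - Z 0\<bar> = exp (- (\<rho> + \<delta>) * s) * \<bar>z s - Z s\<bar>" by (simp add: abs_mult)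
      with bound[OF elim] show ?case by (simp add: mult.commute)
    qed
    ultimately have "\<bar>z 0 - Z 0\<bar> \<le> 0"
      by (intro tendsto_lowerbound[of "\<lambda>s. L * exp (- (\<rho> + \<delta>) * s)"]) auto
    then show ?thesis by simp
  qed (use par in simp)
  show ?thesis
  proof (rule that[of y])
    show "y 0 = x" using Y(2)[of 0] by (simp add: y_def)
    show "l \<le> y s" for s using Y(1) by (simp add: y_def)
    show "discountable (\<rho> + \<delta>) (src y)" by (rule src_disc)
    fix s assume "s \<in> horizon T 0"
    then have sA: "s \<in> A" by (simp add: A_def)
    have "z s = Z s" using diff[OF sA] z0 by simp
    then have "- a * y s + w s = - \<delta> * y s + Z s" by (simp add: z_def a_def algebra_simps)
    with dy[OF sA] show "(y has_real_derivative - \<delta> * y s + discounted_tail (\<rho> + \<delta>) (src y) s) (at s within horizon T 0)"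
      by (simp add: A_def Z_def)
  qed
qed

text \<open>
  The truncation level has to lie below the solution that it produces. Where the two cases differ is
  how this lower bound is obtained. The bound also shows that the solution lies in the class of paths
  that compete for uniqueness.
\<close>

lemma ide_solution_exists:
  assumes par: "0 < \<delta>" "0 < \<rho>" "0 < \<beta>" "0 < T" "0 < x"
  obtains y m where "ide_solution \<delta> \<rho> \<beta> T x y" "0 < m" "\<And>s. s \<in> horizon T 0 \<Longrightarrow> m \<le> y s"
proof -
  note result = that
  define src where "src m y r = indicator (horizon T 0) r * max (y r) m powr (- \<beta>)"
    for m :: real and y :: "real \<Rightarrow> real" and r
  have src: "src m y = source \<beta> T y" if "\<And>s. s \<in> horizon T 0 \<Longrightarrow> m \<le> y s" for m y
    using that by (auto simp: src_def source_def indicator_def)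
  have conclude: thesis if m: "0 < m" "\<And>s. s \<in> horizon T 0 \<Longrightarrow> m \<le> y s" and y: "y 0 = x"
    "discountable (\<rho> + \<delta>) (src m y)"
    "\<And>s. s \<in> horizon T 0 \<Longrightarrow>
       (y has_real_derivative - \<delta> * y s + discounted_tail (\<rho> + \<delta>) (src m y) s) (at s within horizon T 0)"
    for m y
  proof (rule result[OF _ m])
    show "ide_solution \<delta> \<rho> \<beta> T x y"
      unfolding ide_solution_iff[OF par(4)]
    proof (intro conjI ballI)
      show "0 < y s" if "s \<in> horizon T 0" for s using m(1) m(2)[OF that] by simp
      show "discountable (\<rho> + \<delta>) (source \<beta> T y)" using y(2) by (simp only: src[OF m(2)])
      show "(y has_real_derivative - \<delta> * y s + costate \<delta> \<rho> \<beta> T y s) (at s within horizon T 0)"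
        if "s \<in> horizon T 0" for s
        using y(3)[OF that] that costate_eq_tail[of s] by (simp add: src[OF m(2)] horizon_nonneg)
    qed (rule y(1))
  qed
  show thesis
  proof (cases T)
    case (real t)
    \<comment> \<open>The costate is nonnegative, so the state decays at most at rate \<open>\<delta>\<close>.\<close>
    define m where "m = exp (- \<delta> * t) * x"
    have m: "0 < m" using par by (simp add: m_def)
    obtain y where y: "y 0 = x" "\<And>s. 0 \<le> y s" "discountable (\<rho> + \<delta>) (src m y)"
      "\<And>s. s \<in> horizon T 0 \<Longrightarrow>
         (y has_real_derivative - \<delta> * y s + discounted_tail (\<rho> + \<delta>) (src m y) s) (at s within horizon T 0)"
      using truncated_ide_solution[OF par(1-4) m order_refl less_imp_le[OF par(5)]]
      unfolding src_def by auto
    have lower: "m \<le> y s" if s: "s \<in> horizon T 0" for s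
    proof -
      define f where "f r = exp (\<delta> * r) * y r" for r
      have df: "(f has_real_derivative exp (\<delta> * r) * discounted_tail (\<rho> + \<delta>) (src m y) r) (at r within horizon T 0)"
        if "r \<in> horizon T 0" for r
        unfolding f_def by (rule derivative_eq_intros y(4) that refl)+ (simp add: algebra_simps)
      have "f 0 \<le> f s"
      proof (rule DERIV_nonneg_imp_increasing_open[of 0 s f])
        show "continuous_on {0..s} f"
          by (rule continuous_on_subset[OF DERIV_continuous_on[OF df] horizon_Icc[OF s]])
        fix r assume r: "0 < r" "r < s"
        then have rA: "r \<in> horizon T 0" using horizon_Icc[OF s] by auto
        have "0 / (\<rho> + \<delta>) \<le> discounted_tail (\<rho> + \<delta>) (src m y) r"
          using par r by (intro discounted_tail_ge y(3)) (auto simp: src_def)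
        with horizon_Ioo_DERIV[OF df[OF rA] r s]
        show "\<exists>d. (f has_real_derivative d) (at r) \<and> 0 \<le> d" by auto
      qed (use s in \<open>simp add: horizon_def\<close>)
      then have "exp (- \<delta> * s) * x \<le> y s" by (simp add: f_def y(1) exp_minus field_simps)
      moreover have "m \<le> exp (- \<delta> * s) * x"
        using s par real by (simp add: m_def)
      ultimately show ?thesis by simp
    qed
    show thesis by (rule conclude[OF m lower y(1,3,4)])
  next
    case PInf
    \<comment> \<open>A constant is a lower barrier if it is at most \<open>x\<close> and \<open>\<delta> * (\<rho> + \<delta>) * m \<le> m powr (- \<beta>)\<close>, that is, if it does
      not exceed the stationary state. Taking \<open>m \<le> 1\<close> makes the power at least 1, so the second condition
      follows from \<open>\<delta> * (\<rho> + \<delta>) * m \<le> 1\<close>.\<close>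
    define m where "m = min x (min 1 (1 / (\<delta> * (\<rho> + \<delta>))))"
    have m: "0 < m" "m \<le> x" "m \<le> 1" using par by (auto simp: m_def)
    have "\<delta> * (\<rho> + \<delta>) * m \<le> 1"
    proof -
      have "m \<le> 1 / (\<delta> * (\<rho> + \<delta>))" by (simp add: m_def)
      then show ?thesis using par by (subst (asm) pos_le_divide_eq) (simp_all add: mult.commute)
    qed
    also have "1 powr (- \<beta>) \<le> m powr (- \<beta>)" using m par by (intro powr_mono2') auto
    then have "1 \<le> m powr (- \<beta>)" by simp
    finally have low: "\<delta> * (\<rho> + \<delta>) * m \<le> max m m powr (- \<beta>)" by simp
    obtain y where y: "y 0 = x" "\<And>s. m \<le> y s" "discountable (\<rho> + \<delta>) (src m y)"
      "\<And>s. s \<in> horizon T 0 \<Longrightarrow>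
         (y has_real_derivative - \<delta> * y s + discounted_tail (\<rho> + \<delta>) (src m y) s) (at s within horizon T 0)"
      using truncated_ide_solution[OF par(1-4) m(1) less_imp_le[OF m(1)] m(2) low] PInf
      unfolding src_def by auto
    show thesis by (rule conclude[OF m(1) y(2,1,3,4)])
  qed (use par in simp)
qed

section \<open>The payoff as a complete square\<close>

lemma borel_measurable_horizon_iff:
  fixes f :: "real \<Rightarrow> real"
  shows "f \<in> borel_measurable (restrict_space borel (horizon T 0)) \<longleftrightarrow>
    (\<lambda>s. indicator (horizon T 0) s * f s) \<in> borel_measurable borel"
  by (subst borel_measurable_restrict_space_iff) auto

lemma continuous_on_horizon_measurable:
  fixes f :: "real \<Rightarrow> real"
  assumes "continuous_on (horizon T 0) f"
  shows "(\<lambda>s. indicator (horizon T 0) s * f s) \<in> borel_measurable borel"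
  using borel_measurable_continuous_on_indicator[OF horizon_sets assms] by simp

lemma source_measurable:
  assumes "q \<in> positive_paths T"
  shows "source \<beta> T q \<in> borel_measurable borel"
proof -
  have [measurable]: "(\<lambda>s. indicator (horizon T 0) s * q s) \<in> borel_measurable borel"
    using assms by (simp add: positive_paths_def borel_measurable_horizon_iff)
  have "source \<beta> T q = (\<lambda>r. indicator (horizon T 0) r * (indicator (horizon T 0) r * q r) powr (- \<beta>))"
    by (auto simp: source_def indicator_def)
  then show ?thesis by simp
qed

text \<open>
  For infinite \<open>T\<close> convergence at time 0 is part of the class; for finite \<open>T\<close> the class requires
  integrability without a discount, and the discount factor is at most 1.
\<close>

lemma class_Q_discountable:
  assumes "0 < T" "0 < \<rho> + \<delta>" "q \<in> class_Q \<delta> \<rho> \<beta> T"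
  shows "discountable (\<rho> + \<delta>) (source \<beta> T q)"
proof (cases T)
  case (real t)
  from assms real have q: "q \<in> positive_paths T" "set_integrable lborel ({0..t} - {0}) (\<lambda>r. q r powr (- \<beta>))"
    by (auto simp: class_Q_def)
  have "set_integrable lborel {0..t} (\<lambda>r. q r powr (- \<beta>))"
    using q(2) by (rule set_integrable_discrete_difference[where X="{0}", THEN iffD1, rotated -1]) auto
  then have i: "integrable lborel (source \<beta> T q)"
    by (simp add: set_integrable_def source_def[abs_def] real)
  show ?thesis
    unfolding set_integrable_def
  proof (rule Bochner_Integration.integrable_bound[OF i])
    show "(\<lambda>r. indicator {0..} r *\<^sub>R (exp (- (\<rho> + \<delta>) * r) * source \<beta> T q r)) \<in> borel_measurable lborel"
      using source_measurable[OF q(1), of \<beta>] by measurable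
    show "AE r in lborel. norm (indicator {0..} r *\<^sub>R (exp (- (\<rho> + \<delta>) * r) * source \<beta> T q r))
        \<le> norm (source \<beta> T q r)"
    proof (rule AE_I2)
      fix r :: real
      have "exp (- (\<rho> + \<delta>) * r) \<le> 1" if "0 \<le> r"
        using assms(2) that mult_nonneg_nonneg[of "\<rho> + \<delta>" r] by (simp add: algebra_simps)
      then show "norm (indicator {0..} r *\<^sub>R (exp (- (\<rho> + \<delta>) * r) * source \<beta> T q r))
        \<le> norm (source \<beta> T q r)"
        by (auto simp: indicator_def abs_mult intro!: mult_left_le_one_le)
    qed
  qed
next
  case PInf
  then have "set_integrable lborel (horizon T 0) (costate_integrand \<delta> \<rho> \<beta> q 0)"
    using assms by (simp add: class_Q_def)
  then show ?thesis by (simp add: costate_integrable_eq)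
qed (use assms in simp)

lemma costate_continuous:
  assumes "0 < T" "0 < \<rho> + \<delta>" "q \<in> class_Q \<delta> \<rho> \<beta> T"
  shows "continuous_on (horizon T 0) (costate \<delta> \<rho> \<beta> T q)"
  using discounted_tail_continuous[OF class_Q_discountable[OF assms] assms(1)]
  by (rule continuous_on_eq) (simp add: costate_eq_tail horizon_nonneg)

lemma costate_bounded:
  assumes "0 < T" "0 < \<rho> + \<delta>" "q \<in> class_Q \<delta> \<rho> \<beta> T"
  obtains C where "\<And>s. s \<in> horizon T 0 \<Longrightarrow> \<bar>costate \<delta> \<rho> \<beta> T q s\<bar> \<le> C"
proof (cases T)
  case (real t)
  have "bounded (costate \<delta> \<rho> \<beta> T q ` horizon T 0)"
    by (intro compact_imp_bounded compact_continuous_image costate_continuous assms) (simp add: real)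
  with that show ?thesis unfolding bounded_iff by auto
next
  case PInf
  with assms obtain C where "\<forall>s\<ge>0. costate \<delta> \<rho> \<beta> T q s \<le> C" by (auto simp: class_Q_def)
  with that[of C] show ?thesis by (auto simp: costate_nonneg PInf)
qed (use assms in simp)

lemma admissible_locally_integrable:
  assumes "v \<in> admissible \<rho> T" "b \<in> horizon T 0"
  shows "set_integrable lborel {0..b} v"
proof (cases "T = \<infinity>")
  case False
  from assms have [measurable]: "(\<lambda>s. indicator (horizon T 0) s * v s) \<in> borel_measurable borel"
    by (simp add: admissible_def borel_measurable_horizon_iff)
  have sub: "{0..b} \<subseteq> horizon T 0" by (rule horizon_Icc[OF assms(2)])
  have sq: "set_integrable lborel {0..b} (\<lambda>s. (v s)\<^sup>2)"
    using assms False sub by (auto simp: admissible_def intro: set_integrable_subset)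
  have "set_integrable lborel {0..b} (\<lambda>s. 1 + (v s)\<^sup>2)"
    by (intro set_integral_add sq set_integrable_const_Icc)
  then show ?thesis
  proof (rule set_integrable_bound)
    have "(\<lambda>s. indicator {0..b} s *\<^sub>R v s) = (\<lambda>s. indicator {0..b} s *\<^sub>R (indicator (horizon T 0) s * v s))"
      using sub by (auto simp: fun_eq_iff subset_iff split: split_indicator)
    then show "set_borel_measurable lborel {0..b} v"
      unfolding set_borel_measurable_def by simp
    have "\<bar>y\<bar> \<le> 1 + y\<^sup>2" for y :: real
      using sum_squares_ge_zero[of "\<bar>y\<bar> - 1" 0] zero_le_power2[of y]
      by (simp add: power2_eq_square algebra_simps)
    then show "AE s in lborel. s \<in> {0..b} \<longrightarrow> norm (v s) \<le> norm (1 + (v s)\<^sup>2)"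
      by (auto simp: abs_of_nonneg add_nonneg_nonneg)
  qed
qed (use assms in \<open>auto simp: admissible_def\<close>)

lemma admissible_discounted_square_integrable:
  assumes "0 < \<rho>" "v \<in> admissible \<rho> T"
  shows "set_integrable lborel (horizon T 0) (\<lambda>s. exp (- \<rho> * s) * (v s)\<^sup>2)"
proof (cases "T = \<infinity>")
  case False
  from assms have [measurable]: "(\<lambda>s. indicator (horizon T 0) s * v s) \<in> borel_measurable borel"
    by (simp add: admissible_def borel_measurable_horizon_iff)
  have "set_integrable lborel (horizon T 0) (\<lambda>s. (v s)\<^sup>2)"
    using assms False by (auto simp: admissible_def)
  then show ?thesis
  proof (rule set_integrable_bound)
    have "(\<lambda>s. indicator (horizon T 0) s *\<^sub>R (exp (- \<rho> * s) * (v s)\<^sup>2))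
      = (\<lambda>s. exp (- \<rho> * s) * (indicator (horizon T 0) s * v s)\<^sup>2)"
      by (auto simp: indicator_def)
    then show "set_borel_measurable lborel (horizon T 0) (\<lambda>s. exp (- \<rho> * s) * (v s)\<^sup>2)"
      unfolding set_borel_measurable_def by simp
    show "AE s in lborel. s \<in> horizon T 0 \<longrightarrow> norm (exp (- \<rho> * s) * (v s)\<^sup>2) \<le> norm ((v s)\<^sup>2)"
      using assms(1) by (intro AE_I2) (auto simp: abs_mult horizon_def intro!: mult_left_le_one_le)
  qed
qed (use assms in \<open>auto simp: admissible_def\<close>)

text \<open>
  Admissibility matters because the costate is the candidate for the optimal control. It is bounded,
  and a bounded function is square integrable against the discount \<open>exp (- \<rho> * s)\<close>.
\<close>

lemma costate_admissible:
  assumes "0 < T" "0 < \<delta>" "0 < \<rho>" "q \<in> class_Q \<delta> \<rho> \<beta> T"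
  shows "costate \<delta> \<rho> \<beta> T q \<in> admissible \<rho> T"
proof -
  let ?z = "costate \<delta> \<rho> \<beta> T q"
  have cont: "continuous_on (horizon T 0) ?z"
    using assms by (intro costate_continuous) auto
  obtain C where C: "\<And>s. s \<in> horizon T 0 \<Longrightarrow> \<bar>?z s\<bar> \<le> C"
    using costate_bounded[of T \<rho> \<delta> q \<beta>] assms by auto
  have "set_integrable lborel {0..s} ?z" if "s \<in> horizon T 0" for s
    by (intro borel_integrable_atLeastAtMost' continuous_on_subset[OF cont] horizon_Icc that)
  moreover have "set_integrable lborel {0..} (\<lambda>s. exp (- \<rho> * s) * (?z s)\<^sup>2)" if "T = \<infinity>"
  proof (rule set_integrable_bound)
    show "set_integrable lborel {0..} (\<lambda>s. C\<^sup>2 * exp (- \<rho> * (s - 0)))"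
      by (intro set_integrable_mult_right exp_discount_integral assms)
    have "continuous_on {0..} (\<lambda>s. exp (- \<rho> * s) * (?z s)\<^sup>2)"
      using cont that by (intro continuous_intros) auto
    then show "set_borel_measurable lborel {0..} (\<lambda>s. exp (- \<rho> * s) * (?z s)\<^sup>2)"
      using borel_measurable_continuous_on_indicator[of "{0..}" "\<lambda>s. exp (- \<rho> * s) * (?z s)\<^sup>2"]
      unfolding set_borel_measurable_def measurable_lborel1 by simp
    show "AE s in lborel. s \<in> {0..} \<longrightarrow> norm (exp (- \<rho> * s) * (?z s)\<^sup>2) \<le> norm (C\<^sup>2 * exp (- \<rho> * (s - 0)))"
    proof (intro AE_I2 impI)
      fix s :: real assume "s \<in> {0..}"
      with that have "(?z s)\<^sup>2 \<le> C\<^sup>2" using C[of s] by (intro abs_le_square_iff[THEN iffD1]) auto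
      then show "norm (exp (- \<rho> * s) * (?z s)\<^sup>2) \<le> norm (C\<^sup>2 * exp (- \<rho> * (s - 0)))"
        by (simp add: abs_mult mult.commute mult_right_mono)
    qed
  qed
  moreover have "set_integrable lborel (horizon T 0) (\<lambda>s. (?z s)\<^sup>2)" if "T \<noteq> \<infinity>"
    using that assms(1) cont
    by (cases T) (auto intro!: borel_integrable_atLeastAtMost' continuous_intros)
  ultimately show ?thesis
    using continuous_on_horizon_measurable[OF cont]
    by (auto simp: admissible_def borel_measurable_horizon_iff costate_nonneg)
qed

text \<open>
  Where the integrand is integrable, both parts are finite and the extended integral is the usual one.
\<close>

lemma ext_integral_eq:
  assumes "set_integrable lborel A f"
  shows "ext_integral A f = ereal (LINT s:A|lborel. f s)"
proof -
  define g where "g s = indicator A s * f s" for s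
  have g: "integrable lborel g" using assms by (simp add: g_def[abs_def] set_integrable_def)
  have "(\<integral>\<^sup>+s\<in>A. ennreal (f s) \<partial>lborel) = (\<integral>\<^sup>+s. ennreal (g s) \<partial>lborel)"
    "(\<integral>\<^sup>+s\<in>A. ennreal (- f s) \<partial>lborel) = (\<integral>\<^sup>+s. ennreal (- g s) \<partial>lborel)"
    by (auto intro!: nn_integral_cong simp: g_def indicator_def)
  moreover from g have "(\<integral>\<^sup>+s. ennreal (g s) \<partial>lborel) \<noteq> \<infinity>" "(\<integral>\<^sup>+s. ennreal (- g s) \<partial>lborel) \<noteq> \<infinity>"
    by (auto simp: real_integrable_def)
  then have "enn2ereal (\<integral>\<^sup>+s. ennreal (g s) \<partial>lborel) - enn2ereal (\<integral>\<^sup>+s. ennreal (- g s) \<partial>lborel)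
      = ereal (enn2real (\<integral>\<^sup>+s. ennreal (g s) \<partial>lborel) - enn2real (\<integral>\<^sup>+s. ennreal (- g s) \<partial>lborel))"
    by (cases "\<integral>\<^sup>+s. ennreal (g s) \<partial>lborel"; cases "\<integral>\<^sup>+s. ennreal (- g s) \<partial>lborel") auto
  moreover have "(LINT s:A|lborel. f s) = enn2real (\<integral>\<^sup>+s. ennreal (g s) \<partial>lborel) - enn2real (\<integral>\<^sup>+s. ennreal (- g s) \<partial>lborel)"
    using real_lebesgue_integral_def[OF g] by (simp add: set_lebesgue_integral_def g_def[abs_def])
  ultimately show ?thesis by (simp add: ext_integral_def)
qed

text \<open>
  The state with initial value 0 accumulates past controls, the costate discounts future rewards:
  exchanging the two integrations moves the discount factor from one to the other. All functions are
  nonnegative, so integrability need not be known beforehand.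
\<close>

lemma tonelli_state_source:
  assumes "0 < T" "0 < \<rho> + \<delta>" "q \<in> class_Q \<delta> \<rho> \<beta> T" "v \<in> admissible \<rho> T"
  shows "(\<integral>\<^sup>+s. ennreal (exp (- \<rho> * s) * source \<beta> T q s * state \<delta> v s 0) \<partial>lborel) =
    (\<integral>\<^sup>+r. ennreal (indicator (horizon T 0) r * (exp (- \<rho> * r) * costate \<delta> \<rho> \<beta> T q r * v r)) \<partial>lborel)"
proof -
  define A where "A = horizon T 0"
  define V where "V r = indicator A r * v r" for r
  define p where "p s = exp (- (\<rho> + \<delta>) * s) * source \<beta> T q s" for s
  have V_nn: "0 \<le> V r" for r
    using assms(4) by (auto simp: V_def A_def admissible_def indicator_def)
  have [measurable]: "V \<in> borel_measurable borel"
    using assms(4) unfolding V_def A_def by (simp add: admissible_def borel_measurable_horizon_iff)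
  have q: "q \<in> positive_paths T" using assms by (simp add: class_Q_def)
  have [measurable]: "p \<in> borel_measurable borel"
    using source_measurable[OF q, of \<beta>] unfolding p_def by measurable
  have p_nn: "0 \<le> p s" for s by (simp add: p_def source_nonneg)
  have disc: "discountable (\<rho> + \<delta>) (source \<beta> T q)" by (rule class_Q_discountable[OF assms(1-3)])
  \<comment> \<open>The discount for the elapsed time \<open>s - r\<close> splits between the two integrals.\<close>
  have exp_split: "exp (- (\<rho> + \<delta>) * s) = exp (- \<rho> * s) * exp (- \<delta> * s)" for s
    by (simp add: exp_add[symmetric] algebra_simps)
  have inner: "ennreal (exp (- \<rho> * s) * source \<beta> T q s * state \<delta> v s 0)
      = (\<integral>\<^sup>+r. ennreal (p s * (indicator {0..s} r * (exp (\<delta> * r) * V r))) \<partial>lborel)" for s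
  proof (cases "s \<in> A")
    case True
    then have sub: "{0..s} \<subseteq> A" using horizon_Icc by (auto simp: A_def)
    have "set_integrable lborel {0..s} v"
      using admissible_locally_integrable[OF assms(4)] True by (simp add: A_def)
    from set_integrable_exp_mult[OF this]
    have i: "set_integrable lborel {0..s} (\<lambda>r. exp (\<delta> * r) * v r)" .
    have eq: "(\<lambda>r. indicator {0..s} r * (exp (\<delta> * r) * V r)) = (\<lambda>r. indicator {0..s} r *\<^sub>R (exp (\<delta> * r) * v r))"
      using sub by (auto simp: V_def fun_eq_iff subset_iff split: split_indicator)
    have "(\<integral>\<^sup>+r. ennreal (p s * (indicator {0..s} r * (exp (\<delta> * r) * V r))) \<partial>lborel)
        = ennreal (LINT r|lborel. p s * (indicator {0..s} r * (exp (\<delta> * r) * V r)))"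
      by (rule nn_integral_eq_integral)
         (use i in \<open>auto simp: eq set_integrable_def p_nn V_nn\<close>)
    also have "(LINT r|lborel. p s * (indicator {0..s} r * (exp (\<delta> * r) * V r)))
        = p s * (LINT r:{0..s}|lborel. exp (\<delta> * r) * v r)"
      unfolding set_lebesgue_integral_def integral_mult_right_zero
      by (rule arg_cong[OF arg_cong[OF eq]])
    also have "\<dots> = exp (- \<rho> * s) * source \<beta> T q s * state \<delta> v s 0"
      using exp_split by (simp add: p_def state_eq)
    finally show ?thesis by simp
  next
    case False
    then show ?thesis by (simp add: p_def source_def A_def)
  qed
  have outer: "(\<integral>\<^sup>+s. ennreal (p s * (indicator {0..s} r * (exp (\<delta> * r) * V r))) \<partial>lborel)
      = ennreal (indicator A r * (exp (- \<rho> * r) * costate \<delta> \<rho> \<beta> T q r * v r))" for r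
  proof (cases "r \<in> A")
    case True
    then have r: "0 \<le> r" by (simp add: A_def horizon_def)
    have i: "set_integrable lborel {r..} p"
      unfolding p_def using disc by (rule set_integrable_subset) (use r in auto)
    have "costate \<delta> \<rho> \<beta> T q r = exp ((\<rho> + \<delta>) * r) * (LINT s:{r..}|lborel. p s)"
      unfolding costate_eq_tail[OF r] discounted_tail_def discount_shift p_def
      by (rule set_integral_mult_right)
    then have "(LINT s:{r..}|lborel. p s) = exp (- (\<rho> + \<delta>) * r) * costate \<delta> \<rho> \<beta> T q r"
      by (simp only: mult_minus_left exp_minus) simp
    then have "exp (\<delta> * r) * V r * (LINT s:{r..}|lborel. p s)
      = indicator A r * (exp (- \<rho> * r) * costate \<delta> \<rho> \<beta> T q r * v r)"
      using True exp_split[of r] by (simp add: V_def exp_minus)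
    moreover have "(\<integral>\<^sup>+s. ennreal (p s * (indicator {0..s} r * (exp (\<delta> * r) * V r))) \<partial>lborel)
      = (\<integral>\<^sup>+s. ennreal (exp (\<delta> * r) * V r * (indicator {r..} s *\<^sub>R p s)) \<partial>lborel)"
      using r by (intro nn_integral_cong) (auto simp: indicator_def algebra_simps)
    moreover have "\<dots> = ennreal (LINT s|lborel. exp (\<delta> * r) * V r * (indicator {r..} s *\<^sub>R p s))"
      by (rule nn_integral_eq_integral) (use i in \<open>auto simp: set_integrable_def p_nn V_nn\<close>)
    moreover have "(LINT s|lborel. exp (\<delta> * r) * V r * (indicator {r..} s *\<^sub>R p s))
      = exp (\<delta> * r) * V r * (LINT s:{r..}|lborel. p s)"
      by (simp only: integral_mult_right_zero set_lebesgue_integral_def)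
    ultimately show ?thesis by simp
  qed (simp add: V_def)
  have "(\<integral>\<^sup>+s. ennreal (exp (- \<rho> * s) * source \<beta> T q s * state \<delta> v s 0) \<partial>lborel)
      = (\<integral>\<^sup>+s. \<integral>\<^sup>+r. ennreal (p s * (indicator {0..s} r * (exp (\<delta> * r) * V r))) \<partial>lborel \<partial>lborel)"
    by (simp only: inner)
  also have "\<dots> = (\<integral>\<^sup>+r. \<integral>\<^sup>+s. ennreal (p s * (indicator {0..s} r * (exp (\<delta> * r) * V r))) \<partial>lborel \<partial>lborel)"
  proof (rule lborel_pair.Fubini')
    have "(\<lambda>(r, s). ennreal (p s * (indicator {0..s} r * (exp (\<delta> * r) * V r))))
      = (\<lambda>(r, s). ennreal (p s * ((if 0 \<le> r \<and> r \<le> s then 1 else 0) * (exp (\<delta> * r) * V r))))"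
      by (auto simp: indicator_def)
    also have "\<dots> \<in> borel_measurable (lborel \<Otimes>\<^sub>M lborel)" by measurable
    finally show "(\<lambda>(r, s). ennreal (p s * (indicator {0..s} r * (exp (\<delta> * r) * V r))))
      \<in> borel_measurable (lborel \<Otimes>\<^sub>M lborel)" .
  qed
  finally show ?thesis by (simp only: outer A_def)
qed

text \<open>
  The initial state contributes \<open>x\<close> times the costate at time 0, and by Tonelli's theorem the control
  contributes \<open>z * v - v\<^sup>2 / 2 = z\<^sup>2 / 2 - (v - z)\<^sup>2 / 2\<close> under the discounted integral. Everything is integrable,
  as \<open>z * v\<close> is dominated by \<open>v\<^sup>2 + z\<^sup>2\<close>.
\<close>

lemma payoff_complete_square:
  assumes par: "0 < T" "0 < \<delta>" "0 < \<rho>" and q: "q \<in> class_Q \<delta> \<rho> \<beta> T" and v: "v \<in> admissible \<rho> T"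
  defines "z \<equiv> costate \<delta> \<rho> \<beta> T q"
  shows "set_integrable lborel (horizon T 0) (\<lambda>s. exp (- \<rho> * s) * (v s - z s)\<^sup>2)"
    and "payoff \<delta> \<rho> \<beta> T q x v = ereal (x * z 0 + (LINT s:horizon T 0|lborel. exp (- \<rho> * s) * (z s)\<^sup>2) / 2
           - (LINT s:horizon T 0|lborel. exp (- \<rho> * s) * (v s - z s)\<^sup>2) / 2)"
proof -
  let ?A = "horizon T 0"
  have z: "z \<in> admissible \<rho> T" unfolding z_def using par q by (intro costate_admissible) auto
  have pos: "0 < \<rho> + \<delta>" using par by simp
  note qq = class_Q_discountable[OF par(1) pos q]
  have qp: "q \<in> positive_paths T" using q by (simp add: class_Q_def)
  have nn: "0 \<le> v s" "0 \<le> z s" if "s \<in> ?A" for s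
    using v z that by (auto simp: admissible_def)
  have [measurable]: "(\<lambda>s. indicator ?A s * v s) \<in> borel_measurable borel"
    "(\<lambda>s. indicator ?A s * z s) \<in> borel_measurable borel"
    using v z by (auto simp: admissible_def borel_measurable_horizon_iff)
  have iv: "set_integrable lborel ?A (\<lambda>s. exp (- \<rho> * s) * (v s)\<^sup>2)"
    and iz: "set_integrable lborel ?A (\<lambda>s. exp (- \<rho> * s) * (z s)\<^sup>2)"
    using admissible_discounted_square_integrable[OF par(3)] v z by auto
  have izv: "set_integrable lborel ?A (\<lambda>s. exp (- \<rho> * s) * z s * v s)"
  proof (rule set_integrable_bound)
    show "set_integrable lborel ?A (\<lambda>s. exp (- \<rho> * s) * (v s)\<^sup>2 + exp (- \<rho> * s) * (z s)\<^sup>2)"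
      using iv iz by (rule set_integral_add)
    have "(\<lambda>s. indicator ?A s *\<^sub>R (exp (- \<rho> * s) * z s * v s)) =
      (\<lambda>s. exp (- \<rho> * s) * (indicator ?A s * z s) * (indicator ?A s * v s))"
      by (auto simp: indicator_def)
    then show "set_borel_measurable lborel ?A (\<lambda>s. exp (- \<rho> * s) * z s * v s)"
      unfolding set_borel_measurable_def by simp
    show "AE s in lborel. s \<in> ?A \<longrightarrow> norm (exp (- \<rho> * s) * z s * v s)
       \<le> norm (exp (- \<rho> * s) * (v s)\<^sup>2 + exp (- \<rho> * s) * (z s)\<^sup>2)"
    proof (intro AE_I2 impI)
      fix s assume s: "s \<in> ?A"
      have "2 * (z s * v s) \<le> (v s)\<^sup>2 + (z s)\<^sup>2"
        using zero_le_power2[of "v s - z s"] by (simp add: power2_diff algebra_simps)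
      moreover have "0 \<le> z s * v s" using nn[OF s] by simp
      ultimately have "z s * v s \<le> (v s)\<^sup>2 + (z s)\<^sup>2" by linarith
      then have "exp (- \<rho> * s) * (z s * v s) \<le> exp (- \<rho> * s) * ((v s)\<^sup>2 + (z s)\<^sup>2)"
        by (intro mult_left_mono) auto
      then show "norm (exp (- \<rho> * s) * z s * v s) \<le> norm (exp (- \<rho> * s) * (v s)\<^sup>2 + exp (- \<rho> * s) * (z s)\<^sup>2)"
        using nn[OF s] by (simp add: abs_mult distrib_left[symmetric] mult.assoc)
    qed
  qed
  have square: "exp (- \<rho> * s) * (v s - z s)\<^sup>2 = exp (- \<rho> * s) * (v s)\<^sup>2 + exp (- \<rho> * s) * (z s)\<^sup>2
      - 2 * (exp (- \<rho> * s) * z s * v s)" for s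
    by (simp add: power2_diff algebra_simps)
  show isq: "set_integrable lborel ?A (\<lambda>s. exp (- \<rho> * s) * (v s - z s)\<^sup>2)"
    unfolding square by (intro set_integral_add set_integral_diff set_integrable_mult_right iv iz izv)
  have Isq: "(LINT s:?A|lborel. exp (- \<rho> * s) * (v s - z s)\<^sup>2) =
      (LINT s:?A|lborel. exp (- \<rho> * s) * (v s)\<^sup>2) + (LINT s:?A|lborel. exp (- \<rho> * s) * (z s)\<^sup>2)
      - 2 * (LINT s:?A|lborel. exp (- \<rho> * s) * z s * v s)"
    unfolding square
    using set_integral_add[OF iv iz] set_integral_diff[OF set_integral_add(1)[OF iv iz] set_integrable_mult_right[OF izv, of 2]]
    by simp
  define g where "g s = exp (- \<rho> * s) * source \<beta> T q s * state \<delta> v s 0" for s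
  have g_nn: "0 \<le> g s" for s
  proof (cases "s \<in> ?A")
    case True
    then have s: "0 \<le> s" "{0..s} \<subseteq> ?A" using horizon_Icc by (auto simp: horizon_def)
    have "0 \<le> state \<delta> v s 0"
      by (rule state_ge[OF s(1) order_refl]) (use s True nn admissible_locally_integrable[OF v] in auto)
    then show ?thesis by (simp add: g_def source_nonneg)
  qed (simp add: g_def source_def)
  have g_meas: "g \<in> borel_measurable lborel"
  proof -
    have [measurable]: "(\<lambda>s. indicator ?A s * state \<delta> v s 0) \<in> borel_measurable borel"
      by (intro continuous_on_horizon_measurable state_continuous admissible_locally_integrable[OF v] par)
    note source_measurable[OF qp, measurable]
    have "g = (\<lambda>s. exp (- \<rho> * s) * source \<beta> T q s * (indicator ?A s * state \<delta> v s 0))"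
      by (auto simp: g_def source_def indicator_def)
    then show ?thesis by simp
  qed
  let ?I = "LINT s:?A|lborel. exp (- \<rho> * s) * z s * v s"
  have "(\<integral>\<^sup>+s. ennreal (g s) \<partial>lborel) = ennreal ?I"
  proof -
    have "(\<integral>\<^sup>+s. ennreal (indicator ?A s * (exp (- \<rho> * s) * z s * v s)) \<partial>lborel) = ennreal ?I"
      unfolding set_lebesgue_integral_def
      by (subst nn_integral_eq_integral) (use izv nn in \<open>auto simp: set_integrable_def indicator_def\<close>)
    then show ?thesis unfolding g_def z_def by (simp only: tonelli_state_source[OF par(1) pos q v])
  qed
  moreover have "0 \<le> ?I"
    unfolding set_lebesgue_integral_def by (intro Bochner_Integration.integral_nonneg) (use nn in \<open>auto simp: indicator_def\<close>)
  ultimately have ig: "integrable lborel g" "(LINT s|lborel. g s) = ?I"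
    using nn_integral_eq_integrable[OF g_meas _ \<open>0 \<le> ?I\<close>] g_nn by auto
  let ?p = "\<lambda>s. indicator {0..} s *\<^sub>R (exp (- (\<rho> + \<delta>) * s) * source \<beta> T q s)"
  have ip: "integrable lborel ?p" "(LINT s|lborel. ?p s) = z 0"
    using qq by (simp_all add: set_integrable_def z_def costate_eq_tail discounted_tail_def set_lebesgue_integral_def)
  let ?v = "\<lambda>s. indicator ?A s *\<^sub>R (exp (- \<rho> * s) * (v s)\<^sup>2)"
  have iv': "integrable lborel ?v" using iv by (simp add: set_integrable_def)
  have split: "indicator ?A s *\<^sub>R (exp (- \<rho> * s) * (state \<delta> v s x * q s powr (- \<beta>) - (v s)\<^sup>2 / 2))
     = x * ?p s + g s - ?v s / 2" for s
  proof (cases "s \<in> ?A")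
    case True
    have "exp (- (\<rho> + \<delta>) * s) = exp (- \<rho> * s) * exp (- \<delta> * s)"
      by (simp add: exp_add[symmetric] algebra_simps)
    moreover have "state \<delta> v s x = exp (- \<delta> * s) * x + state \<delta> v s 0" by (simp add: state_def)
    ultimately show ?thesis
      using True by (simp add: g_def source_def horizon_nonneg algebra_simps)
  qed (simp add: g_def source_def)
  have sum: "integrable lborel (\<lambda>s. x * ?p s + g s - ?v s / 2)"
    by (intro Bochner_Integration.integrable_diff Bochner_Integration.integrable_add integrable_mult_right
          integrable_divide ip ig iv')
  then have "set_integrable lborel ?A (\<lambda>s. exp (- \<rho> * s) * (state \<delta> v s x * q s powr (- \<beta>) - (v s)\<^sup>2 / 2))"
    unfolding set_integrable_def by (simp only: split)
  then have "payoff \<delta> \<rho> \<beta> T q x v = ereal (LINT s|lborel. x * ?p s + g s - ?v s / 2)"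
    unfolding payoff_def by (simp only: ext_integral_eq set_lebesgue_integral_def split)
  also have "(LINT s|lborel. x * ?p s + g s - ?v s / 2) = x * z 0 + ?I - (LINT s|lborel. ?v s) / 2"
    by (subst Bochner_Integration.integral_diff Bochner_Integration.integral_add;
        (intro Bochner_Integration.integrable_add integrable_mult_right integrable_divide ip ig iv')?)+
       (simp only: integral_mult_right_zero integral_divide_zero ip ig)
  also have "\<dots> = x * z 0 + (LINT s:?A|lborel. exp (- \<rho> * s) * (z s)\<^sup>2) / 2
           - (LINT s:?A|lborel. exp (- \<rho> * s) * (v s - z s)\<^sup>2) / 2"
    unfolding Isq by (simp add: set_lebesgue_integral_def field_simps)
  finally show "payoff \<delta> \<rho> \<beta> T q x v = ereal (x * z 0 + (LINT s:horizon T 0|lborel. exp (- \<rho> * s) * (z s)\<^sup>2) / 2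
           - (LINT s:horizon T 0|lborel. exp (- \<rho> * s) * (v s - z s)\<^sup>2) / 2)" .
qed

section \<open>Equilibria and solutions of the equation\<close>

lemma payoff_le_costate:
  assumes "0 < T" "0 < \<delta>" "0 < \<rho>" "q \<in> class_Q \<delta> \<rho> \<beta> T" "v \<in> admissible \<rho> T"
  shows "payoff \<delta> \<rho> \<beta> T q x v \<le> payoff \<delta> \<rho> \<beta> T q x (costate \<delta> \<rho> \<beta> T q)"
proof -
  have "0 \<le> (LINT s:horizon T 0|lborel. exp (- \<rho> * s) * (v s - costate \<delta> \<rho> \<beta> T q s)\<^sup>2)"
    unfolding set_lebesgue_integral_def by (intro Bochner_Integration.integral_nonneg) simp
  then show ?thesis
    using payoff_complete_square(2)[OF assms, of x]
      payoff_complete_square(2)[OF assms(1-4) costate_admissible[OF assms(1-4)], of x]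
    by simp
qed

lemma optimal_control_AE_costate:
  assumes "0 < T" "0 < \<delta>" "0 < \<rho>" "q \<in> class_Q \<delta> \<rho> \<beta> T" "u \<in> admissible \<rho> T"
    and "payoff \<delta> \<rho> \<beta> T q x (costate \<delta> \<rho> \<beta> T q) \<le> payoff \<delta> \<rho> \<beta> T q x u"
  shows "AE s in lborel. s \<in> horizon T 0 \<longrightarrow> u s = costate \<delta> \<rho> \<beta> T q s"
proof -
  let ?f = "\<lambda>s. indicator (horizon T 0) s *\<^sub>R (exp (- \<rho> * s) * (u s - costate \<delta> \<rho> \<beta> T q s)\<^sup>2)"
  have i: "integrable lborel ?f"
    using payoff_complete_square(1)[OF assms(1-5)] by (simp add: set_integrable_def)
  have "integral\<^sup>L lborel ?f \<le> 0"
    using payoff_complete_square(2)[OF assms(1-5), of x] assms(6)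
      payoff_complete_square(2)[OF assms(1-4) costate_admissible[OF assms(1-4)], of x]
    by (simp add: set_lebesgue_integral_def)
  moreover have "0 \<le> integral\<^sup>L lborel ?f"
    by (intro Bochner_Integration.integral_nonneg) simp
  ultimately have "integral\<^sup>L lborel ?f = 0" by (rule antisym)
  then have "AE s in lborel. ?f s = 0"
    by (subst (asm) integral_nonneg_eq_0_iff_AE[OF i]) auto
  then show ?thesis by eventually_elim auto
qed

text \<open>
  The flow is affine in the initial state and maps positive states to positive states, so restricting
  the law to \<open>(0,+\<infinity>)\<close> loses nothing and the mean passes through the flow.
\<close>

lemma state_law_mean:
  assumes \<nu>: "prob_space \<nu>" "sets \<nu> = sets pos_borel" "integrable \<nu> (\<lambda>x. x)"
    and u: "\<And>r. 0 \<le> r \<Longrightarrow> r \<le> s \<Longrightarrow> 0 \<le> u r"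
  shows "(LINT x:{0<..}|state_law \<delta> \<nu> u s. x) = state \<delta> u s (LINT y|\<nu>. y)"
proof -
  interpret prob_space \<nu> by fact
  define k where "k = (LINT r:{0..s}|lborel. exp (- \<delta> * (s - r)) * u r)"
  have k: "0 \<le> k"
    unfolding k_def set_lebesgue_integral_def
    by (intro Bochner_Integration.integral_nonneg) (use u in \<open>auto simp: indicator_def\<close>)
  have sp: "space \<nu> = {0<..}"
    using sets_eq_imp_space_eq[OF \<nu>(2)] by simp
  have st: "state \<delta> u s x = exp (- \<delta> * s) * x + k" for x by (simp add: state_def k_def)
  have [measurable]: "state \<delta> u s \<in> measurable \<nu> borel"
    using borel_measurable_integrable[OF \<nu>(3)] unfolding st[abs_def] by measurable
  have "(LINT x:{0<..}|state_law \<delta> \<nu> u s. x)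
      = (LINT x|\<nu>. indicator {0<..} (state \<delta> u s x) *\<^sub>R state \<delta> u s x)"
    unfolding state_law_def set_lebesgue_integral_def by (rule integral_distr) measurable
  also have "\<dots> = (LINT x|\<nu>. exp (- \<delta> * s) * x + k)"
    by (rule Bochner_Integration.integral_cong)
       (use k in \<open>auto simp: sp st indicator_def add_pos_nonneg\<close>)
  also have "\<dots> = state \<delta> u s (LINT y|\<nu>. y)"
    using \<nu>(3) by (simp add: st prob_space)
  finally show ?thesis .
qed

lemma positive_mean:
  assumes \<nu>: "prob_space \<nu>" "sets \<nu> = sets pos_borel" "integrable \<nu> (\<lambda>x. x)"
  shows "0 < (LINT y|\<nu>. y)"
proof -
  interpret prob_space \<nu> by fact
  have sp: "space \<nu> = {0<..}"
    using sets_eq_imp_space_eq[OF \<nu>(2)] by simp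
  have nn: "AE y in \<nu>. 0 \<le> y" by (rule AE_I2) (simp add: sp)
  have "(LINT y|\<nu>. y) \<noteq> 0"
  proof
    assume "(LINT y|\<nu>. y) = 0"
    then have "AE y in \<nu>. y = 0" using integral_nonneg_eq_0_iff_AE[OF \<nu>(3) nn] by simp
    moreover have "AE y in \<nu>. y \<noteq> 0" by (rule AE_I2) (simp add: sp)
    ultimately have "AE y in \<nu>. False" by eventually_elim simp
    then show False by simp
  qed
  with integral_nonneg_AE[OF nn] show ?thesis by simp
qed

text \<open>
  A lower bound on the path bounds \<open>y powr (- \<beta>)\<close> from above, and hence its discounted tails.
\<close>

lemma ide_solution_class_Q:
  assumes par: "0 < \<delta>" "0 < \<rho>" "0 < \<beta>" "0 < T"
    and y: "ide_solution \<delta> \<rho> \<beta> T x y" and m: "0 < m" "\<And>s. s \<in> horizon T 0 \<Longrightarrow> m \<le> y s"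
  shows "y \<in> class_Q \<delta> \<rho> \<beta> T"
proof -
  have cont: "continuous_on (horizon T 0) y" by (rule ide_solution_continuous[OF par(4) y])
  have disc: "discountable (\<rho> + \<delta>) (source \<beta> T y)" and pos: "\<And>s. s \<in> horizon T 0 \<Longrightarrow> 0 < y s"
    using y by (auto simp: ide_solution_iff[OF par(4)])
  have pp: "y \<in> positive_paths T"
    unfolding positive_paths_def borel_measurable_horizon_iff
    using continuous_on_horizon_measurable[OF cont] pos by simp
  have cont': "continuous_on (horizon T 0) (\<lambda>r. y r powr (- \<beta>))"
    by (intro continuous_on_powr cont continuous_on_const ballI) (auto dest: pos)
  have loc: "set_integrable lborel {0..b} (\<lambda>r. y r powr (- \<beta>))" if "b \<in> horizon T 0" for b
    by (intro borel_integrable_atLeastAtMost' continuous_on_subset[OF cont'] horizon_Icc that)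
  have src: "\<bar>source \<beta> T y r\<bar> \<le> m powr (- \<beta>)" for r
    using powr_mono2'[of "- \<beta>" m "y r"] m par by (auto simp: source_def indicator_def)
  show ?thesis
  proof (cases T)
    case (real t)
    with loc[of t] par have "set_integrable lborel {0..t} (\<lambda>r. y r powr (- \<beta>))" by simp
    then have "set_integrable lborel ({0..t} - {0}) (\<lambda>r. y r powr (- \<beta>))"
      by (rule set_integrable_subset) auto
    with pp real show ?thesis by (simp add: class_Q_def)
  next
    case PInf
    have "set_integrable lborel {s..} (costate_integrand \<delta> \<rho> \<beta> y s)" if "0 \<le> s" for s
      using costate_integrable_eq[OF that, of T] discountable_tail_integrable[OF disc that] PInf by simp
    moreover have "costate \<delta> \<rho> \<beta> T y s \<le> m powr (- \<beta>) / (\<rho> + \<delta>)" if "0 \<le> s" for s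
      unfolding costate_eq_tail[OF that]
      using discounted_tail_abs_le[OF _ disc that src] par by simp
    ultimately show ?thesis
      using pp loc PInf by (auto simp: class_Q_def)
  qed (use par in simp)
qed

text \<open>
  The optimal control does not depend on the initial state, so a single initial state for which
  \<open>u\<close> is optimal suffices; one exists since a property cannot hold almost surely without holding
  somewhere.
\<close>

lemma equilibrium_imp_costate:
  assumes par: "0 < \<delta>" "0 < \<rho>" "0 < \<beta>" "0 < T"
    and \<nu>: "prob_space \<nu>" "sets \<nu> = sets pos_borel" "integrable \<nu> (\<lambda>x. x)"
    and eq: "equilibrium \<delta> \<rho> \<beta> T \<nu> u q" and q: "q \<in> class_Q \<delta> \<rho> \<beta> T"
  shows "AE s in lborel. s \<in> horizon T 0 \<longrightarrow> u s = costate \<delta> \<rho> \<beta> T q s"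
proof -
  interpret prob_space \<nu> by fact
  have sp: "space \<nu> = {0<..}"
    using sets_eq_imp_space_eq[OF \<nu>(2)] by simp
  have ae: "AE x in \<nu>. \<forall>v\<in>admissible \<rho> T. payoff \<delta> \<rho> \<beta> T q x v \<le> payoff \<delta> \<rho> \<beta> T q x u"
    using eq AE_space unfolding equilibrium_def by (auto simp: sp)
  have "\<exists>x. \<forall>v\<in>admissible \<rho> T. payoff \<delta> \<rho> \<beta> T q x v \<le> payoff \<delta> \<rho> \<beta> T q x u"
  proof (rule ccontr)
    assume "\<nexists>x. \<forall>v\<in>admissible \<rho> T. payoff \<delta> \<rho> \<beta> T q x v \<le> payoff \<delta> \<rho> \<beta> T q x u"
    then have "AE x in \<nu>. False" by (intro eventually_mono[OF ae]) blast
    then show False by simp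
  qed
  then obtain x where "\<forall>v\<in>admissible \<rho> T. payoff \<delta> \<rho> \<beta> T q x v \<le> payoff \<delta> \<rho> \<beta> T q x u" ..
  then show ?thesis
    using eq costate_admissible[OF par(4,1,2) q]
    by (intro optimal_control_AE_costate[OF par(4,1,2) q]) (auto simp: equilibrium_def)
qed

text \<open>
  A path in equilibrium is merely measurable at first. Being the mean of the flow, it is the state
  driven by its own costate, and since costates are continuous it is differentiable.
\<close>

lemma equilibrium_imp_ide_solution:
  assumes par: "0 < \<delta>" "0 < \<rho>" "0 < \<beta>" "0 < T"
    and \<nu>: "prob_space \<nu>" "sets \<nu> = sets pos_borel" "integrable \<nu> (\<lambda>x. x)"
    and eq: "equilibrium \<delta> \<rho> \<beta> T \<nu> u q" and q: "q \<in> class_Q \<delta> \<rho> \<beta> T"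
  shows "ide_solution \<delta> \<rho> \<beta> T (LINT y|\<nu>. y) q"
proof -
  let ?z = "costate \<delta> \<rho> \<beta> T q" and ?x = "LINT y|\<nu>. y"
  have pos: "0 < \<rho> + \<delta>" using par by simp
  have u: "u \<in> admissible \<rho> T" using eq by (simp add: equilibrium_def)
  have z: "?z \<in> admissible \<rho> T" by (rule costate_admissible[OF par(4,1,2) q])
  have ae: "AE s in lborel. s \<in> horizon T 0 \<longrightarrow> u s = ?z s"
    by (rule equilibrium_imp_costate[OF par \<nu> eq q])
  have q_eq: "q s = state \<delta> ?z s ?x" if s: "s \<in> horizon T 0" for s
  proof -
    have sub: "{0..s} \<subseteq> horizon T 0" by (rule horizon_Icc[OF s])
    have "q s = (LINT x:{0<..}|state_law \<delta> \<nu> u s. x)" using eq s by (simp add: equilibrium_def)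
    also have "\<dots> = state \<delta> u s ?x"
      by (rule state_law_mean[OF \<nu>]) (use u sub in \<open>auto simp: admissible_def\<close>)
    also have "\<dots> = state \<delta> ?z s ?x"
    proof -
      have "(LINT r:{0..s}|lborel. exp (\<delta> * r) * u r) = (LINT r:{0..s}|lborel. exp (\<delta> * r) * ?z r)"
        unfolding set_lebesgue_integral_def
      proof (rule integral_cong_AE)
        have "set_integrable lborel {0..s} (\<lambda>r. exp (\<delta> * r) * u r)"
          "set_integrable lborel {0..s} (\<lambda>r. exp (\<delta> * r) * ?z r)"
          by (rule set_integrable_exp_mult[OF admissible_locally_integrable[OF u s]]
                set_integrable_exp_mult[OF admissible_locally_integrable[OF z s]])+
        then show "(\<lambda>r. indicator {0..s} r *\<^sub>R (exp (\<delta> * r) * u r)) \<in> borel_measurable lborel"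
          "(\<lambda>r. indicator {0..s} r *\<^sub>R (exp (\<delta> * r) * ?z r)) \<in> borel_measurable lborel"
          unfolding set_integrable_def by (auto dest: borel_measurable_integrable)
        show "AE r in lborel. indicator {0..s} r *\<^sub>R (exp (\<delta> * r) * u r)
            = indicator {0..s} r *\<^sub>R (exp (\<delta> * r) * ?z r)"
          using ae by eventually_elim (use sub in \<open>auto simp: indicator_def\<close>)
      qed
      then show ?thesis by (simp add: state_eq)
    qed
    finally show ?thesis .
  qed
  have "0 \<in> horizon T 0" using par(4) by (simp add: horizon_def zero_ereal_def)
  show ?thesis
    unfolding ide_solution_iff[OF par(4)]
  proof (intro conjI ballI)
    show "0 < q s" if "s \<in> horizon T 0" for s
      using q that by (auto simp: class_Q_def positive_paths_def)
    show "discountable (\<rho> + \<delta>) (source \<beta> T q)" by (rule class_Q_discountable[OF par(4) pos q])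
    show "q 0 = ?x" using q_eq[OF \<open>0 \<in> horizon T 0\<close>] by simp
    fix s assume s: "s \<in> horizon T 0"
    show "(q has_real_derivative - \<delta> * q s + ?z s) (at s within horizon T 0)"
      using s q_eq
    proof (rule has_real_derivative_transform)
      show "((\<lambda>s. state \<delta> ?z s ?x) has_real_derivative - \<delta> * q s + ?z s) (at s within horizon T 0)"
        using state_has_derivative[OF par(4) costate_continuous[OF par(4) pos q] s] q_eq[OF s] by simp
    qed
  qed
qed

text \<open>
  The solution and the state driven by its costate satisfy the same linear equation, so they coincide;
  this is the consistency condition. Optimality of the costate holds for every path of the class.
\<close>

lemma ide_solution_imp_equilibrium:
  assumes par: "0 < \<delta>" "0 < \<rho>" "0 < \<beta>" "0 < T"
    and \<nu>: "prob_space \<nu>" "sets \<nu> = sets pos_borel" "integrable \<nu> (\<lambda>x. x)"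
    and y: "ide_solution \<delta> \<rho> \<beta> T (LINT y|\<nu>. y) q" and q: "q \<in> class_Q \<delta> \<rho> \<beta> T"
  shows "equilibrium \<delta> \<rho> \<beta> T \<nu> (costate \<delta> \<rho> \<beta> T q) q"
proof -
  let ?z = "costate \<delta> \<rho> \<beta> T q" and ?x = "LINT y|\<nu>. y"
  have pos: "0 < \<rho> + \<delta>" using par by simp
  have z: "?z \<in> admissible \<rho> T" by (rule costate_admissible[OF par(4,1,2) q])
  have "q s = (LINT x:{0<..}|state_law \<delta> \<nu> ?z s. x)" if s: "s \<in> horizon T 0" for s
  proof -
    have "q s - state \<delta> ?z s ?x = exp (- \<delta> * s) * (q 0 - state \<delta> ?z 0 ?x)"
    proof (rule linear_ode_solution[OF _ s])
      fix r assume r: "r \<in> horizon T 0"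
      have "(q has_real_derivative - \<delta> * q r + ?z r) (at r within horizon T 0)"
        using y r by (auto simp: ide_solution_iff[OF par(4)])
      from DERIV_diff[OF this state_has_derivative[OF par(4) costate_continuous[OF par(4) pos q] r]]
      show "((\<lambda>s. q s - state \<delta> ?z s ?x) has_real_derivative - \<delta> * (q r - state \<delta> ?z r ?x))
        (at r within horizon T 0)"
        by (simp add: algebra_simps)
    qed
    also have "\<dots> = 0" using y by (simp add: ide_solution_iff[OF par(4)])
    finally show ?thesis by (simp add: state_law_mean[OF \<nu>] costate_nonneg)
  qed
  with z q show ?thesis
    using payoff_le_costate[OF par(4,1,2) q] by (auto simp: equilibrium_def class_Q_def)
qed

lemma costate_cong:
  assumes "0 \<le> s" "\<And>r. r \<in> horizon T 0 \<Longrightarrow> q r = q' r"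
  shows "costate \<delta> \<rho> \<beta> T q s = costate \<delta> \<rho> \<beta> T q' s"
proof -
  have "source \<beta> T q = source \<beta> T q'"
    using assms(2) by (auto simp: source_def fun_eq_iff split: split_indicator)
  then show ?thesis using assms(1) by (simp add: costate_eq_tail)
qed

theorem mean_field_equilibrium:
  assumes par: "0 < \<delta>" "0 < \<rho>" "0 < \<beta>" "0 < T"
    and \<nu>: "prob_space \<nu>" "sets \<nu> = sets pos_borel" "integrable \<nu> (\<lambda>x. x)"
  shows "\<exists>u q. unique_equilibrium \<delta> \<rho> \<beta> T \<nu> u q \<and>
           (\<forall>s\<in>horizon T 0. u s = costate \<delta> \<rho> \<beta> T q s) \<and>
           unique_ide_solution \<delta> \<rho> \<beta> T (LINT y|\<nu>. y) q"
proof -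
  let ?x = "LINT y|\<nu>. y"
  obtain q m where q: "ide_solution \<delta> \<rho> \<beta> T ?x q" and m: "0 < m" "\<And>s. s \<in> horizon T 0 \<Longrightarrow> m \<le> q s"
    using ide_solution_exists[OF par positive_mean[OF \<nu>]] by blast
  have Q: "q \<in> class_Q \<delta> \<rho> \<beta> T" by (rule ide_solution_class_Q[OF par q m])
  let ?z = "costate \<delta> \<rho> \<beta> T q"
  have "unique_equilibrium \<delta> \<rho> \<beta> T \<nu> ?z q"
    unfolding unique_equilibrium_def
  proof (intro conjI allI impI)
    show "equilibrium \<delta> \<rho> \<beta> T \<nu> ?z q" by (rule ide_solution_imp_equilibrium[OF par \<nu> q Q])
    show "q \<in> class_Q \<delta> \<rho> \<beta> T" by fact
    fix u' q' assume e: "equilibrium \<delta> \<rho> \<beta> T \<nu> u' q' \<and> q' \<in> class_Q \<delta> \<rho> \<beta> T"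
    then have "ide_solution \<delta> \<rho> \<beta> T ?x q'"
      by (intro equilibrium_imp_ide_solution[OF par \<nu>]) auto
    from ide_solution_unique[OF par(3,4) q this]
    show q': "\<forall>s\<in>horizon T 0. q' s = q s" by blast
    have "costate \<delta> \<rho> \<beta> T q' s = ?z s" if "s \<in> horizon T 0" for s
      by (rule costate_cong) (use q' that in \<open>auto simp: horizon_nonneg\<close>)
    moreover have "AE s in lborel. s \<in> horizon T 0 \<longrightarrow> u' s = costate \<delta> \<rho> \<beta> T q' s"
      using e by (intro equilibrium_imp_costate[OF par \<nu>]) auto
    ultimately show "AE s in lborel. s \<in> horizon T 0 \<longrightarrow> u' s = ?z s" by auto
  qed
  moreover have "unique_ide_solution \<delta> \<rho> \<beta> T ?x q"
    unfolding unique_ide_solution_def using q ide_solution_unique[OF par(3,4) q] by blast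
  ultimately show ?thesis by blast
qed

theorem theorem5p8:
  fixes \<delta> \<rho> \<beta> :: real and T :: ereal
  assumes "0 < \<delta>" and "0 < \<rho>" and "0 < \<beta>"
    and "0 < T" and "T = \<infinity> \<Longrightarrow> \<beta> < 1 + \<rho> / \<delta>"
  shows "(\<forall>\<nu> :: real measure.
            prob_space \<nu> \<and> sets \<nu> = sets pos_borel \<and> integrable \<nu> (\<lambda>x. x) \<longrightarrow>
            (\<exists>u q. unique_equilibrium \<delta> \<rho> \<beta> T \<nu> u q \<and>
                   (\<forall>s\<in>horizon T 0. u s = costate \<delta> \<rho> \<beta> T q s) \<and>
                   unique_ide_solution \<delta> \<rho> \<beta> T (LINT y|\<nu>. y) q)) \<and>
         (\<forall>x>0. \<exists>u q. unique_equilibrium \<delta> \<rho> \<beta> T (return pos_borel x) u q \<and>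
                   (\<forall>s\<in>horizon T 0. u s = costate \<delta> \<rho> \<beta> T q s) \<and>
                   unique_ide_solution \<delta> \<rho> \<beta> T x q)"
proof (intro conjI allI impI)
  fix \<nu> :: "real measure"
  assume "prob_space \<nu> \<and> sets \<nu> = sets pos_borel \<and> integrable \<nu> (\<lambda>x. x)"
  then show "\<exists>u q. unique_equilibrium \<delta> \<rho> \<beta> T \<nu> u q \<and>
       (\<forall>s\<in>horizon T 0. u s = costate \<delta> \<rho> \<beta> T q s) \<and>
       unique_ide_solution \<delta> \<rho> \<beta> T (LINT y|\<nu>. y) q"
    by (intro mean_field_equilibrium[OF assms(1-4)]) auto
next
  fix x :: real assume x: "0 < x"
  let ?\<nu> = "return pos_borel x"
  have sp: "x \<in> space pos_borel" using x by simp
  have [measurable]: "(\<lambda>x::real. x) \<in> borel_measurable pos_borel"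
    by (rule measurable_restrict_space1) simp
  have mean: "(LINT y|?\<nu>. y) = x"
    by (rule integral_return[OF sp]) measurable
  moreover have "integrable ?\<nu> (\<lambda>x. x)"
    using sp by (intro integrableI_bounded) (auto simp: nn_integral_return)
  ultimately show "\<exists>u q. unique_equilibrium \<delta> \<rho> \<beta> T ?\<nu> u q \<and>
       (\<forall>s\<in>horizon T 0. u s = costate \<delta> \<rho> \<beta> T q s) \<and>
       unique_ide_solution \<delta> \<rho> \<beta> T x q"
    using mean_field_equilibrium[OF assms(1-4) prob_space_return[OF sp]] by simp
qed

end
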